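(* Let $\Omega$ be either a domain of Class 1 or a strip $\mathbb R\times(0,L)$ with $L>0$. Let $\mu,\lambda$ be such that there is a measurable set $K\subseteq\Omega$ with $0<|K|<\infty$, $0<\mu\le\mu_K$ and $\lambda>\lambda_K$. Then each minimizer $\omega\in S_{\mu,\lambda}$ satisfies $$\omega=\lambda(\psi-Wx_2-\gamma)_+,\qquad \psi(x)=\int_\Omega G(x,y)\omega(y)\,dy,$$ for some constants $W,\gamma\in\mathbb R$, uniquely determined by $\omega$.
   Context: Points are $x=(x_1,x_2)$, $\mathbb R^2_+=\{x_2>0\}$, $t_+=\max\{t,0\}$, $|K|$ is Lebesgue measure. Class 1: a domain $\mathcal D\subseteq\mathbb R^2_+$ such that, with $D_u=\mathcal D\cap\{x_2\ge1\}$ and $D_l=\mathcal D\cap\{x_2<1\}$, the weak finite volume condition holds: $|D_u|<\infty$ and $\int_{D_l}x_2^p\,dx<\infty$ for some $p\ge0$; and such that the Biot–Savart law is applicable on $\mathcal D$ (velocity recovered from vorticity $\omega$ as $u=\nabla^\perp\int_{\mathcal D}G(x,y)\omega(y)dy$). $G$ is the Green's function of $-\Delta$ on $\Omega$ with zero Dirichlet boundary condition; with $G_H$ the one for $\mathbb R^2_+$, $0\le G\le G_H$. On the strip $\mathbb R\times(0,L)$, $$G(x,y)=\frac1{4\pi}\ln\Big(1+\frac{\sin(\frac{\pi}{L}x_2)\sin(\frac{\pi}{L}y_2)}{\sinh(\frac{\pi}{2L}(x_1-y_1))^2+\sin(\frac{\pi}{2L}(x_2-y_2))^2}\Big).$$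 $$E[\omega]=\frac12\int_\Omega\int_\Omega G(x,y)\omega(x)\omega(y)\,dx\,dy,\qquad E_{2,\lambda}[\omega]=E[\omega]-\frac1{2\lambda}\|\omega\|_{L^2(\Omega)}^2,$$ $$K_{\mu}=\Big\{\omega\in L^2(\Omega):\ \omega\ge0,\ \int_\Omega x_2\omega\,dx=\mu,\ \int_\Omega\omega\,dx\le1\Big\},\qquad I_{\mu,\lambda}=\inf_{\omega\in K_{\mu}}\{-E_{2,\lambda}[\omega]\}.$$ $S_{\mu,\lambda}\subseteq K_\mu$ is the set of minimizers of $I_{\mu,\lambda}$. For measurable $K\subseteq\Omega$ with $0<|K|<\infty$: $\mu_K=\frac1{|K|}\int_Kx_2\,dx$ and $\lambda_K=|K|\big/\int_K\int_KG(x,y)\,dy\,dx$. *)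

theory Defs
  imports "HOL-Analysis.Analysis"
begin

text \<open>
  Points of the plane are pairs \<open>x = (fst x, snd x)\<close>; the norm on \<open>real \<times> real\<close> is Euclidean.
  Integrals are taken against \<open>lebesgue_on \<Omega>\<close>, and elements of \<open>L\<^sup>2(\<Omega>)\<close> are represented by
  functions, so pointwise statements about them are stated almost everywhere.
\<close>

type_synonym plane = "real \<times> real"

definition upper_half_plane :: "plane set" where
  "upper_half_plane = {x. 0 < snd x}"

definition strip :: "real \<Rightarrow> plane set" where
  "strip L = UNIV \<times> {0<..<L}"

subsection \<open>Differential operators\<close>

definition pd1 :: "(plane \<Rightarrow> real) \<Rightarrow> plane \<Rightarrow> real" where
  "pd1 f x = frechet_derivative f (at x) (1, 0)"

definition pd2 :: "(plane \<Rightarrow> real) \<Rightarrow> plane \<Rightarrow> real" where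
  "pd2 f x = frechet_derivative f (at x) (0, 1)"

primrec Ck_on :: "nat \<Rightarrow> plane set \<Rightarrow> (plane \<Rightarrow> real) \<Rightarrow> bool" where
  "Ck_on 0 S f \<longleftrightarrow> continuous_on S f"
| "Ck_on (Suc k) S f \<longleftrightarrow>
     (\<forall>x\<in>S. f differentiable (at x)) \<and> Ck_on k S (pd1 f) \<and> Ck_on k S (pd2 f)"

definition harmonic_on :: "plane set \<Rightarrow> (plane \<Rightarrow> real) \<Rightarrow> bool" where
  "harmonic_on S f \<longleftrightarrow> Ck_on 2 S f \<and> (\<forall>x\<in>S. pd1 (pd1 f) x + pd2 (pd2 f) x = 0)"

definition curl :: "(plane \<Rightarrow> plane) \<Rightarrow> plane \<Rightarrow> real" where
  "curl u x = pd1 (\<lambda>z. snd (u z)) x - pd2 (\<lambda>z. fst (u z)) x"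

definition test_function :: "(plane \<Rightarrow> real) \<Rightarrow> bool" where
  "test_function \<phi> \<longleftrightarrow>
     (\<forall>k. Ck_on k UNIV \<phi>) \<and> (\<exists>C. compact C \<and> (\<forall>x. x \<notin> C \<longrightarrow> \<phi> x = 0))"

subsection \<open>Green's function\<close>

definition half_plane_green :: "plane \<Rightarrow> plane \<Rightarrow> real" where
  "half_plane_green x y = 1 / (4 * pi) * ln (1 + 4 * snd x * snd y / (norm (x - y))\<^sup>2)"

text \<open>
  \<open>G\<close> is the Green's function of the negative Laplacian on an open subset \<open>\<Omega>\<close> of the half plane,
  with zero Dirichlet boundary condition.  The first clause says that minus the Laplacian of
  \<open>G(\<sqdot>,y)\<close> is the unit mass at \<open>y\<close>, the second is the boundary condition.  On an unbounded \<open>\<Omega>\<close>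
  these two leave \<open>G\<close> undetermined (on a strip one may add multiples of
  \<open>exp (\<pi>x\<^sub>1/L) sin (\<pi>x\<^sub>2/L)\<close>); the comparison with the half plane forces decay at
  infinity, and \<open>G\<close> is then unique off the diagonal by the maximum principle.  The values
  \<open>G x x\<close> are left unspecified.
\<close>

definition green_function :: "plane set \<Rightarrow> (plane \<Rightarrow> plane \<Rightarrow> real) \<Rightarrow> bool" where
  "green_function \<Omega> G \<longleftrightarrow>
     (\<forall>y\<in>\<Omega>.
        (\<exists>h. harmonic_on \<Omega> h \<and>
             (\<forall>x\<in>\<Omega> - {y}. G x y = - ln (norm (x - y)) / (2 * pi) + h x)) \<and>
        (\<forall>z\<in>frontier \<Omega>. ((\<lambda>x. G x y) \<longlongrightarrow> 0) (at z within \<Omega>)) \<and>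
        (\<forall>x\<in>\<Omega> - {y}. 0 \<le> G x y \<and> G x y \<le> half_plane_green x y))"

definition stream :: "(plane \<Rightarrow> plane \<Rightarrow> real) \<Rightarrow> plane set \<Rightarrow> (plane \<Rightarrow> real) \<Rightarrow> plane \<Rightarrow> real" where
  "stream G \<Omega> \<omega> x = (LINT y|lebesgue_on \<Omega>. G x y * \<omega> y)"

subsection \<open>Domains of Class 1\<close>

text \<open>
  Velocity fields have finite kinetic energy.  Testing against functions that do not vanish on the
  boundary makes the last clause encode both incompressibility in \<open>D\<close> and tangency to the
  boundary of \<open>D\<close>, without any regularity of that boundary.
\<close>

definition velocity_field :: "plane set \<Rightarrow> (plane \<Rightarrow> plane) \<Rightarrow> bool" where
  "velocity_field D u \<longleftrightarrow>
     Ck_on 1 D (\<lambda>x. fst (u x)) \<and> Ck_on 1 D (\<lambda>x. snd (u x)) \<and>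
     integrable (lebesgue_on D) (\<lambda>x. (norm (u x))\<^sup>2) \<and>
     (\<forall>\<phi>. test_function \<phi> \<longrightarrow>
        (LINT x|lebesgue_on D. fst (u x) * pd1 \<phi> x + snd (u x) * pd2 \<phi> x) = 0)"

text \<open>
  The velocity is recovered from its vorticity \<open>\<omega> = curl u\<close> as the perpendicular gradient
  \<open>(\<partial>\<^sub>2\<psi>, - \<partial>\<^sub>1\<psi>)\<close> of the stream function \<open>\<psi>\<close>.  The integrability of \<open>\<omega>\<close> required here is
  that of the admissible vorticities below, up to sign.
\<close>

definition biot_savart_applicable :: "plane set \<Rightarrow> (plane \<Rightarrow> plane \<Rightarrow> real) \<Rightarrow> bool" where
  "biot_savart_applicable D G \<longleftrightarrow>
     (\<forall>u. velocity_field D u \<longrightarrow>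
          integrable (lebesgue_on D) (curl u) \<longrightarrow>
          integrable (lebesgue_on D) (\<lambda>x. (curl u x)\<^sup>2) \<longrightarrow>
          integrable (lebesgue_on D) (\<lambda>x. snd x * curl u x) \<longrightarrow>
          (\<forall>x\<in>D. \<exists>d. GDERIV (stream G D (curl u)) x :> d \<and> u x = (snd d, - fst d)))"

definition weak_finite_volume :: "plane set \<Rightarrow> bool" where
  "weak_finite_volume D \<longleftrightarrow>
     emeasure lebesgue (D \<inter> {x. 1 \<le> snd x}) < \<infinity> \<and>
     (\<exists>p\<ge>0. (\<integral>\<^sup>+x\<in>D \<inter> {x. snd x < 1}. ennreal (snd x powr p) \<partial>lebesgue) < \<infinity>)"

definition class1 :: "plane set \<Rightarrow> (plane \<Rightarrow> plane \<Rightarrow> real) \<Rightarrow> bool" where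
  "class1 D G \<longleftrightarrow>
     open D \<and> connected D \<and> D \<noteq> {} \<and> D \<subseteq> upper_half_plane \<and>
     weak_finite_volume D \<and> biot_savart_applicable D G"

subsection \<open>The variational problem\<close>

text \<open>
  On \<open>admissible \<Omega> \<mu>\<close> all integrals below converge absolutely, since
  \<open>0 \<le> G \<le> half_plane_green\<close>.
\<close>

definition energy :: "(plane \<Rightarrow> plane \<Rightarrow> real) \<Rightarrow> plane set \<Rightarrow> (plane \<Rightarrow> real) \<Rightarrow> real" where
  "energy G \<Omega> \<omega> =
     1 / 2 * (LINT x|lebesgue_on \<Omega>. LINT y|lebesgue_on \<Omega>. G x y * \<omega> x * \<omega> y)"

definition energy2 ::
  "(plane \<Rightarrow> plane \<Rightarrow> real) \<Rightarrow> plane set \<Rightarrow> real \<Rightarrow> (plane \<Rightarrow> real) \<Rightarrow> real" where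
  "energy2 G \<Omega> lam \<omega> = energy G \<Omega> \<omega> - 1 / (2 * lam) * (LINT x|lebesgue_on \<Omega>. (\<omega> x)\<^sup>2)"

definition admissible :: "plane set \<Rightarrow> real \<Rightarrow> (plane \<Rightarrow> real) set" where
  "admissible \<Omega> \<mu> =
     {\<omega>. \<omega> \<in> borel_measurable (lebesgue_on \<Omega>) \<and>
         integrable (lebesgue_on \<Omega>) (\<lambda>x. (\<omega> x)\<^sup>2) \<and>
         (AE x in lebesgue_on \<Omega>. 0 \<le> \<omega> x) \<and>
         integrable (lebesgue_on \<Omega>) (\<lambda>x. snd x * \<omega> x) \<and>
         (LINT x|lebesgue_on \<Omega>. snd x * \<omega> x) = \<mu> \<and>
         integrable (lebesgue_on \<Omega>) \<omega> \<and>
         (LINT x|lebesgue_on \<Omega>. \<omega> x) \<le> 1}"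

definition min_value :: "(plane \<Rightarrow> plane \<Rightarrow> real) \<Rightarrow> plane set \<Rightarrow> real \<Rightarrow> real \<Rightarrow> ereal" where
  "min_value G \<Omega> \<mu> lam = (INF \<omega>\<in>admissible \<Omega> \<mu>. ereal (- energy2 G \<Omega> lam \<omega>))"

definition minimizers ::
  "(plane \<Rightarrow> plane \<Rightarrow> real) \<Rightarrow> plane set \<Rightarrow> real \<Rightarrow> real \<Rightarrow> (plane \<Rightarrow> real) set" where
  "minimizers G \<Omega> \<mu> lam =
     {\<omega> \<in> admissible \<Omega> \<mu>. ereal (- energy2 G \<Omega> lam \<omega>) = min_value G \<Omega> \<mu> lam}"

text \<open>
  These are extended nonnegative reals: a set of finite measure in an unbounded domain may have
  infinite mean height, or infinite self-energy, in which case \<open>lambda_of G K = 0\<close>.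
\<close>

definition mu_of :: "plane set \<Rightarrow> ennreal" where
  "mu_of K = (\<integral>\<^sup>+x\<in>K. ennreal (snd x) \<partial>lebesgue) / emeasure lebesgue K"

definition lambda_of :: "(plane \<Rightarrow> plane \<Rightarrow> real) \<Rightarrow> plane set \<Rightarrow> ennreal" where
  "lambda_of G K =
     emeasure lebesgue K / (\<integral>\<^sup>+x\<in>K. (\<integral>\<^sup>+y\<in>K. ennreal (G x y) \<partial>lebesgue) \<partial>lebesgue)"

end

theory Submission
  imports Defs
begin

text \<open>
  Write \<open>\<psi>\<close> for the stream function of a minimizer \<open>\<omega>\<close>.  The first variation of the energy at
  \<open>\<omega>\<close> is integration against \<open>g = \<psi> - \<omega> / \<lambda>\<close>, provided that \<open>G\<close> is symmetric.  Correct a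
  bounded test function with bounded support by two functions that live where \<open>\<omega>\<close> is bounded below
  and are dual to the moments of \<open>1\<close> and \<open>x\<^sub>2\<close>; the corrected variation is admissible, and the
  integrals of \<open>g\<close> against the dual functions are the multipliers \<open>\<gamma>\<close> and \<open>W\<close>.  Testing with
  indicators gives \<open>g \<le> W x\<^sub>2 + \<gamma>\<close>, with equality where \<open>\<omega> > 0\<close>; this is the asserted formula.
  Uniqueness holds because \<open>\<omega> > 0\<close> on a set of positive measure, on which \<open>x\<^sub>2\<close> is not constant.

  For the symmetry of \<open>G\<close>, the four-point stencil
  applied to the pole of \<open>G\<close> changes its boundary values only by \<open>O(r^4)\<close>, so that, by the maximum
  principle in the first variable, \<open>G x\<close> is discretely harmonic.  Comparing \<open>G x y\<close> with
  \<open>G y x\<close> as functions of \<open>y\<close> then only needs that the latter vanishes at the boundary.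
\<close>

subsection \<open>A maximum principle for the discrete Laplacian\<close>

definition discrete_laplacian :: "(plane \<Rightarrow> real) \<Rightarrow> plane \<Rightarrow> real \<Rightarrow> real" where
  "discrete_laplacian u y r =
     u (y + (r, 0)) + u (y - (r, 0)) + u (y + (0, r)) + u (y - (0, r)) - 4 * u y"

text \<open>
  A form of harmonicity that can be verified for \<open>y \<mapsto> G x y\<close>, about whose derivatives nothing is
  known, and that still yields the maximum principle.
\<close>

definition laplace_null_at :: "(plane \<Rightarrow> real) \<Rightarrow> plane \<Rightarrow> bool" where
  "laplace_null_at u y \<longleftrightarrow> ((\<lambda>r. discrete_laplacian u y r / r\<^sup>2) \<longlongrightarrow> 0) (at_right 0)"

text \<open>The stencil is exact on quadratic polynomials. This is the strictly subharmonic
  perturbation used in \<open>maximum_principle\<close>.\<close>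

lemma discrete_laplacian_norm_sq:
  "discrete_laplacian (\<lambda>x. (norm (x - a))\<^sup>2) y r = 4 * r\<^sup>2"
  unfolding discrete_laplacian_def power2_norm_eq_inner
  by (simp add: inner_prod_def power2_eq_square algebra_simps)

lemma laplace_null_at_diff:
  assumes "laplace_null_at u y" "laplace_null_at v y"
  shows "laplace_null_at (\<lambda>x. u x - v x) y"
proof -
  have "((\<lambda>r. discrete_laplacian u y r / r\<^sup>2 - discrete_laplacian v y r / r\<^sup>2) \<longlongrightarrow> 0 - 0) (at_right 0)"
    using assms unfolding laplace_null_at_def by (intro tendsto_diff)
  moreover have "discrete_laplacian u y r / r\<^sup>2 - discrete_laplacian v y r / r\<^sup>2
      = discrete_laplacian (\<lambda>x. u x - v x) y r / r\<^sup>2" for r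
    by (simp add: discrete_laplacian_def diff_divide_distrib[symmetric])
  ultimately show ?thesis
    by (simp add: laplace_null_at_def)
qed

lemma laplace_null_at_cmult:
  assumes "laplace_null_at u y"
  shows "laplace_null_at (\<lambda>x. c * u x) y"
proof -
  have "((\<lambda>r. c * (discrete_laplacian u y r / r\<^sup>2)) \<longlongrightarrow> c * 0) (at_right 0)"
    using assms unfolding laplace_null_at_def by (intro tendsto_mult tendsto_const)
  moreover have "c * (discrete_laplacian u y r / r\<^sup>2) = discrete_laplacian (\<lambda>x. c * u x) y r / r\<^sup>2" for r
    by (simp add: discrete_laplacian_def algebra_simps)
  ultimately show ?thesis
    by (simp only: laplace_null_at_def mult_zero_right)
qed

lemma laplace_null_at_add:
  assumes "laplace_null_at u y" "laplace_null_at v y"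
  shows "laplace_null_at (\<lambda>x. u x + v x) y"
  using laplace_null_at_diff[OF assms(1) laplace_null_at_cmult[OF assms(2), of "-1"]] by simp

section \<open>Second differences of harmonic functions, and the maximum principle\<close>

text \<open>L'Hopital is applied only once: \<open>f'\<close> is differentiable at 0 alone, so the
  quotient of first derivatives has to be handled directly. It is the mean of the right and left
  difference quotients of \<open>f'\<close> at 0.\<close>

lemma second_difference_limit:
  fixes f f' :: "real \<Rightarrow> real"
  assumes "e > 0" and f: "\<And>s. \<bar>s\<bar> < e \<Longrightarrow> (f has_real_derivative f' s) (at s)"
    and f': "(f' has_real_derivative c) (at 0)"
  shows "((\<lambda>r. (f r + f (- r) - 2 * f 0) / r\<^sup>2) \<longlongrightarrow> c) (at_right 0)"
proof (rule lhopital_right_0[where f' = "\<lambda>r. f' r - f' (- r)" and g' = "\<lambda>r. 2 * r"])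
  have cont: "isCont f 0"
    using f[of 0] \<open>e > 0\<close> DERIV_isCont by auto
  have "((\<lambda>r. f r + f (- r) - 2 * f 0) \<longlongrightarrow> f 0 + f (- 0) - 2 * f 0) (at 0)"
    using cont by (intro tendsto_intros isCont_tendsto_compose[of "- 0" f]) (auto simp: isCont_def)
  then show "((\<lambda>r. f r + f (- r) - 2 * f 0) \<longlongrightarrow> 0) (at_right 0)"
    by (simp add: filterlim_at_split)
  show "((\<lambda>r::real. r\<^sup>2) \<longlongrightarrow> 0) (at_right 0)"
    by (auto intro!: tendsto_eq_intros)
  have ev: "eventually (\<lambda>r. 0 < r \<and> r < e) (at_right 0)"
    unfolding eventually_at_right_field using \<open>e > 0\<close> by blast
  show "eventually (\<lambda>r::real. r\<^sup>2 \<noteq> 0) (at_right 0)"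
    "eventually (\<lambda>r::real. 2 * r \<noteq> 0) (at_right 0)"
    using ev by (auto elim: eventually_mono)
  show "eventually (\<lambda>r. ((\<lambda>r. f r + f (- r) - 2 * f 0) has_real_derivative (f' r - f' (- r))) (at r)) (at_right 0)"
    using ev
  proof (rule eventually_mono)
    fix r assume r: "0 < r \<and> r < e"
    have "(f has_real_derivative f' r) (at r)" "(f has_real_derivative f' (- r)) (at (- r))"
      using f[of r] f[of "- r"] r by auto
    then show "((\<lambda>r. f r + f (- r) - 2 * f 0) has_real_derivative (f' r - f' (- r))) (at r)"
      by (auto intro!: derivative_eq_intros DERIV_chain'[of uminus "-1" r UNIV f])
  qed
  show "eventually (\<lambda>r::real. ((\<lambda>r. r\<^sup>2) has_real_derivative 2 * r) (at r)) (at_right 0)"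
    by (auto intro!: derivative_eq_intros always_eventually)
  have "((\<lambda>h. (f' (0 + h) - f' 0) / h) \<longlongrightarrow> c) (at 0)"
    using f' by (simp add: DERIV_def)
  then have lr: "((\<lambda>h. (f' h - f' 0) / h) \<longlongrightarrow> c) (at_right 0)" "((\<lambda>h. (f' h - f' 0) / h) \<longlongrightarrow> c) (at_left 0)"
    by (simp_all add: filterlim_at_split)
  \<comment> \<open>The left difference quotient, reflected so that both limits are taken along
    \<open>at_right 0\<close>.\<close>
  have l: "((\<lambda>h. (f' (- h) - f' 0) / (- h)) \<longlongrightarrow> c) (at_right 0)"
    using lr(2) by (simp add: filterlim_at_left_to_right)
  have "((\<lambda>h. ((f' h - f' 0) / h + (f' (- h) - f' 0) / (- h)) / 2) \<longlongrightarrow> (c + c) / 2) (at_right 0)"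
    by (intro tendsto_intros lr l) auto
  moreover have "(\<lambda>h. ((f' h - f' 0) / h + (f' (- h) - f' 0) / (- h)) / 2) = (\<lambda>h. (f' h - f' (- h)) / (2 * h))"
    by (intro ext) (simp add: divide_simps)
  ultimately have "((\<lambda>r. (f' r - f' (- r)) / (2 * r)) \<longlongrightarrow> (c + c) / 2) (at_right 0)"
    by (simp only:)
  then show "((\<lambda>r. (f' r - f' (- r)) / (2 * r)) \<longlongrightarrow> c) (at_right 0)"
    by simp
qed

lemma has_directional_derivative:
  fixes f :: "plane \<Rightarrow> real"
  assumes "f differentiable (at (y + s *\<^sub>R v))"
  shows "((\<lambda>t. f (y + t *\<^sub>R v)) has_real_derivative frechet_derivative f (at (y + s *\<^sub>R v)) v) (at s)"
proof -
  have 1: "(f has_derivative frechet_derivative f (at (y + s *\<^sub>R v))) (at (y + s *\<^sub>R v))"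
    using assms by (simp add: frechet_derivative_works)
  have 2: "((\<lambda>t. y + t *\<^sub>R v) has_derivative (\<lambda>t. t *\<^sub>R v)) (at s)"
    by (auto intro!: derivative_eq_intros)
  have "((\<lambda>t. f (y + t *\<^sub>R v)) has_derivative (\<lambda>t. frechet_derivative f (at (y + s *\<^sub>R v)) (t *\<^sub>R v))) (at s)"
    using diff_chain_at[OF 2 1] by (simp add: o_def)
  moreover have "frechet_derivative f (at (y + s *\<^sub>R v)) (t *\<^sub>R v) = t * frechet_derivative f (at (y + s *\<^sub>R v)) v" for t
    using linear_frechet_derivative[OF assms] by (simp add: linear_scale)
  ultimately show ?thesis
    unfolding has_field_derivative_def mult.commute[of "frechet_derivative f (at (y + s *\<^sub>R v)) v"] by simp
qed

lemma directional_second_difference: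
  fixes f :: "plane \<Rightarrow> real"
  assumes "open S" "y \<in> S" and d: "\<And>x. x \<in> S \<Longrightarrow> f differentiable (at x)"
    and dd: "(\<lambda>x. frechet_derivative f (at x) v) differentiable (at y)"
  shows "((\<lambda>r. (f (y + r *\<^sub>R v) + f (y - r *\<^sub>R v) - 2 * f y) / r\<^sup>2)
           \<longlongrightarrow> frechet_derivative (\<lambda>x. frechet_derivative f (at x) v) (at y) v) (at_right 0)"
proof -
  obtain \<epsilon> where \<epsilon>: "\<epsilon> > 0" "ball y \<epsilon> \<subseteq> S"
    using assms openE by blast
  \<comment> \<open>For \<open>\<bar>s\<bar> < e\<close> the point \<open>y + s *\<^sub>R v\<close>
    stays in the ball; adding 1 avoids a zero denominator when \<open>v = 0\<close>.\<close>
  define e where "e = \<epsilon> / (norm v + 1)"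
  have "norm v + 1 > 0" using norm_ge_zero[of v] by linarith
  then have "e > 0" using \<epsilon> by (simp add: e_def)
  have S: "y + s *\<^sub>R v \<in> S" if "\<bar>s\<bar> < e" for s
  proof -
    have "\<bar>s\<bar> * norm v \<le> \<bar>s\<bar> * (norm v + 1)" by (simp add: algebra_simps)
    also have "\<dots> < \<epsilon>" using that \<open>norm v + 1 > 0\<close> by (simp add: e_def field_simps)
    finally show ?thesis using \<epsilon> by (auto simp: dist_norm)
  qed
  have "((\<lambda>t. f (y + t *\<^sub>R v)) has_real_derivative frechet_derivative f (at (y + s *\<^sub>R v)) v) (at s)" if "\<bar>s\<bar> < e" for s
    by (rule has_directional_derivative[OF d[OF S[OF that]]])
  moreover have "((\<lambda>s. frechet_derivative f (at (y + s *\<^sub>R v)) v) has_real_derivative frechet_derivative (\<lambda>x. frechet_derivative f (at x) v) (at y) v) (at 0)"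
    using has_directional_derivative[where s=0 and y=y and v=v and f="\<lambda>x. frechet_derivative f (at x) v"] dd by simp
  ultimately have "((\<lambda>r. (f (y + r *\<^sub>R v) + f (y + (- r) *\<^sub>R v) - 2 * f (y + 0 *\<^sub>R v)) / r\<^sup>2)
      \<longlongrightarrow> frechet_derivative (\<lambda>x. frechet_derivative f (at x) v) (at y) v) (at_right 0)"
    by (rule second_difference_limit[OF \<open>e > 0\<close>])
  then show ?thesis by simp
qed

text \<open>The stencil is the sum of the second differences along the two axes, and their limits
  add up to the Laplacian.\<close>

lemma harmonic_on_laplace_null:
  assumes "harmonic_on S h" "open S" "y \<in> S"
  shows "laplace_null_at h y"
proof -
  have d: "\<And>x. x \<in> S \<Longrightarrow> h differentiable (at x)"
    and d1: "pd1 h differentiable (at y)" and d2: "pd2 h differentiable (at y)"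
    and lap: "pd1 (pd1 h) y + pd2 (pd2 h) y = 0"
    using assms by (auto simp: harmonic_on_def numeral_2_eq_2)
  have "((\<lambda>r. (h (y + r *\<^sub>R (1, 0)) + h (y - r *\<^sub>R (1, 0)) - 2 * h y) / r\<^sup>2) \<longlongrightarrow> pd1 (pd1 h) y) (at_right 0)"
    using directional_second_difference[OF assms(2,3) d, of "(1,0)"] d1 by (simp add: pd1_def[abs_def])
  moreover have "((\<lambda>r. (h (y + r *\<^sub>R (0, 1)) + h (y - r *\<^sub>R (0, 1)) - 2 * h y) / r\<^sup>2) \<longlongrightarrow> pd2 (pd2 h) y) (at_right 0)"
    using directional_second_difference[OF assms(2,3) d, of "(0,1)"] d2 by (simp add: pd2_def[abs_def])
  ultimately have "((\<lambda>r. (h (y + r *\<^sub>R (1, 0)) + h (y - r *\<^sub>R (1, 0)) - 2 * h y) / r\<^sup>2 +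
      (h (y + r *\<^sub>R (0, 1)) + h (y - r *\<^sub>R (0, 1)) - 2 * h y) / r\<^sup>2) \<longlongrightarrow> 0) (at_right 0)"
    using tendsto_add lap by fastforce
  moreover have "(h (y + r *\<^sub>R (1, 0)) + h (y - r *\<^sub>R (1, 0)) - 2 * h y) / r\<^sup>2 +
      (h (y + r *\<^sub>R (0, 1)) + h (y - r *\<^sub>R (0, 1)) - 2 * h y) / r\<^sup>2 = discrete_laplacian h y r / r\<^sup>2" for r
    by (simp add: discrete_laplacian_def add_divide_distrib[symmetric])
  ultimately show ?thesis
    by (simp add: laplace_null_at_def)
qed

lemma harmonic_on_continuous_on: "harmonic_on S h \<Longrightarrow> continuous_on S h"
  unfolding harmonic_on_def numeral_2_eq_2 Ck_on.simps
  by (meson continuous_at_imp_continuous_on differentiable_imp_continuous_within)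

text \<open>If \<open>u x0\<close> exceeds \<open>B\<close>, adding a small multiple of the squared
  distance to \<open>x0\<close> leaves an interior local maximum at some \<open>y\<close>. There the
  stencil of the sum is nonpositive, so that of \<open>u\<close> is at most
  \<open>- 4 * \<epsilon> * r\<^sup>2\<close>, which contradicts the null limit. The hypothesis
  \<open>small\<close> replaces boundary values and also covers the behaviour at infinity.\<close>

lemma maximum_principle:
  assumes "open S" and cont: "continuous_on S u" and null: "\<And>y. y \<in> S \<Longrightarrow> laplace_null_at u y"
    and small: "\<And>e. e > 0 \<Longrightarrow> \<exists>C. compact C \<and> C \<subseteq> S \<and> (\<forall>x\<in>S - C. u x < B + e)"
    and "x0 \<in> S"
  shows "u x0 \<le> B"
proof (rule ccontr)
  assume "\<not> u x0 \<le> B"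
  define d where "d = (u x0 - B) / 2"
  have "d > 0" using \<open>\<not> u x0 \<le> B\<close> by (simp add: d_def)
  obtain C where C: "compact C" "C \<subseteq> S" "\<forall>x\<in>S - C. u x < B + d"
    using small[OF \<open>d > 0\<close>] by blast
  have "x0 \<in> C"
  proof (rule ccontr)
    assume "x0 \<notin> C"
    then have "u x0 < B + d" using C(3) \<open>x0 \<in> S\<close> by blast
    then show False using \<open>d > 0\<close> by (simp add: d_def field_simps)
  qed
  obtain R where R: "R > 0" "\<And>x. x \<in> C \<Longrightarrow> norm (x - x0) \<le> R"
    using compact_imp_bounded[OF C(1)] bounded_any_center[of C x0]
    by (metis bounded_pos dist_norm dist_commute less_eq_real_def linorder_not_le order_less_le_trans zero_less_one)
  \<comment> \<open>The added term is then at most \<open>d / 2\<close> on \<open>C\<close>, while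
    \<open>u x0 = B + 2 * d\<close>; so the maximizer \<open>y\<close> of \<open>v\<close> still
    satisfies \<open>u y > B + d\<close>.\<close>
  define \<epsilon> where "\<epsilon> = d / (2 * R\<^sup>2)"
  have "\<epsilon> > 0" using \<open>d > 0\<close> R by (simp add: \<epsilon>_def)
  define v where "v x = u x + \<epsilon> * (norm (x - x0))\<^sup>2" for x
  have "continuous_on C v"
    unfolding v_def by (intro continuous_intros continuous_on_subset[OF cont C(2)])
  then obtain y where y: "y \<in> C" "\<And>x. x \<in> C \<Longrightarrow> v x \<le> v y"
    using continuous_attains_sup[OF C(1), of v] \<open>x0 \<in> C\<close> by blast
  have "\<epsilon> * (norm (y - x0))\<^sup>2 \<le> \<epsilon> * R\<^sup>2"
    using R(2)[OF y(1)] \<open>\<epsilon> > 0\<close> by (simp add: power_mono)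
  also have "\<dots> = d / 2" using R by (simp add: \<epsilon>_def)
  finally have "u y \<ge> u x0 - d / 2"
    using y(2)[OF \<open>x0 \<in> C\<close>] by (simp add: v_def)
  then have uy: "u y > B + d"
    using \<open>d > 0\<close> by (simp add: d_def field_simps)
  have "y \<in> S" using y C by auto
  \<comment> \<open>The maximizer might lie on the boundary of \<open>C\<close>. But points of
    \<open>S\<close> where \<open>u\<close> exceeds \<open>B + d\<close> belong to \<open>C\<close>,
    so a whole ball around \<open>y\<close> does.\<close>
  have "open (S \<inter> u -` {B + d<..})"
    by (rule continuous_open_preimage[OF cont \<open>open S\<close>]) simp
  moreover have "y \<in> S \<inter> u -` {B + d<..}" using uy \<open>y \<in> S\<close> by auto
  ultimately obtain e where e: "e > 0" "ball y e \<subseteq> S \<inter> u -` {B + d<..}"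
    by (meson openE)
  have loc: "v x \<le> v y" if "x \<in> ball y e" for x
  proof -
    have "x \<in> S" "u x > B + d" using e(2) that by auto
    then have "x \<in> C" using C(3) by force
    then show ?thesis by (rule y(2))
  qed
  have "discrete_laplacian u y r / r\<^sup>2 \<le> - 4 * \<epsilon>" if "0 < r" "r < e" for r
  proof -
    have "y + (r, 0) \<in> ball y e" "y - (r, 0) \<in> ball y e" "y + (0, r) \<in> ball y e" "y - (0, r) \<in> ball y e"
      using that by (auto simp: dist_norm norm_Pair)
    then have "discrete_laplacian v y r \<le> 0"
      using loc unfolding discrete_laplacian_def by (smt (verit))
    moreover have "discrete_laplacian v y r = discrete_laplacian u y r + \<epsilon> * discrete_laplacian (\<lambda>x. (norm (x - x0))\<^sup>2) y r"
      unfolding v_def discrete_laplacian_def by (simp add: algebra_simps)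
    ultimately show ?thesis
      using that by (simp add: discrete_laplacian_norm_sq divide_simps algebra_simps)
  qed
  then have "eventually (\<lambda>r. discrete_laplacian u y r / r\<^sup>2 \<le> - 4 * \<epsilon>) (at_right 0)"
    using \<open>e > 0\<close> by (auto simp: eventually_at_right_field intro!: exI[of _ e])
  with null[OF \<open>y \<in> S\<close>, unfolded laplace_null_at_def] have "0 \<le> - 4 * \<epsilon>"
    by (rule tendsto_upperbound) simp
  then show False using \<open>\<epsilon> > 0\<close> by simp
qed

text \<open>The set where \<open>u \<ge> e\<close> is bounded by the behaviour at infinity, and the
  boundary limits keep its closure off the frontier. The closure is taken because \<open>u\<close>
  may be discontinuous, as the Green function is at its pole.\<close>

lemma compact_superlevel:
  fixes u :: "plane \<Rightarrow> real"
  assumes "open S" and fr: "\<And>z. z \<in> frontier S \<Longrightarrow> eventually (\<lambda>x. u x < e) (at z within S)"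
    and inf: "\<And>x. x \<in> S \<Longrightarrow> R < norm x \<Longrightarrow> u x < e"
  shows "\<exists>C. compact C \<and> C \<subseteq> S \<and> (\<forall>x\<in>S - C. u x < e)"
proof (intro exI conjI)
  define A where "A = {x\<in>S. u x \<ge> e}"
  have "A \<subseteq> cball 0 R" using inf by (force simp: A_def)
  then show "compact (closure A)"
    using bounded_subset[OF bounded_cball] by (simp add: compact_closure)
  show "\<forall>x\<in>S - closure A. u x < e"
    using closure_subset[of A] by (force simp: A_def)
  show "closure A \<subseteq> S"
  proof
    fix z assume z: "z \<in> closure A"
    show "z \<in> S"
    proof (rule ccontr)
      assume "z \<notin> S"
      have "A \<subseteq> S" by (auto simp: A_def)
      then have "z \<in> frontier S"
        using z \<open>z \<notin> S\<close> closure_mono[of A S] \<open>open S\<close> by (auto simp: frontier_def interior_open)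
      from fr[OF this] obtain d where d: "d > 0" "\<And>x. x \<in> S \<Longrightarrow> x \<noteq> z \<Longrightarrow> dist x z < d \<Longrightarrow> u x < e"
        by (auto simp: eventually_at)
      obtain x where "x \<in> A" "dist x z < d" using z d(1) by (auto simp: closure_approachable)
      then show False using d(2)[of x] \<open>z \<notin> S\<close> by (auto simp: A_def)
    qed
  qed
qed

subsection \<open>Symmetry and continuity of the Green function\<close>

text \<open>Lists of weighted poles allow one argument to serve both the difference of two poles and
  the five-point stencil.\<close>

lemma laplace_null_at_sum_list:
  "(\<And>c z. (c, z) \<in> set cs \<Longrightarrow> laplace_null_at (f z) y) \<Longrightarrow>
   laplace_null_at (\<lambda>x. \<Sum>(c, z)\<leftarrow>cs. c * f z x) y"
proof (induction cs)
  case Nil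
  then show ?case by (simp add: laplace_null_at_def discrete_laplacian_def)
next
  case (Cons a cs)
  then have "laplace_null_at (\<lambda>x. fst a * f (snd a) x) y" "laplace_null_at (\<lambda>x. \<Sum>(c, z)\<leftarrow>cs. c * f z x) y"
    by (cases a, auto intro!: laplace_null_at_cmult)+
  from laplace_null_at_add[OF this] show ?case
    by (cases a) simp
qed

lemma continuous_on_sum_list:
  "(\<And>c z. (c, z) \<in> set cs \<Longrightarrow> continuous_on S (f z)) \<Longrightarrow>
   continuous_on S (\<lambda>x. \<Sum>(c, z)\<leftarrow>cs. (c::real) * f z x)"
  by (induction cs) (auto intro!: continuous_intros)

text \<open>
  With \<open>v = a + i b\<close>, the product is the square of the modulus of \<open>v^4 - r^4\<close>, whence the
  fourth-order accuracy of the stencil.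
\<close>

lemma four_point_product_bounds:
  fixes a b r :: real
  defines "N \<equiv> a\<^sup>2 + b\<^sup>2"
  defines "P \<equiv> ((a - r)\<^sup>2 + b\<^sup>2) * ((a + r)\<^sup>2 + b\<^sup>2) * ((a\<^sup>2 + (b - r)\<^sup>2) * (a\<^sup>2 + (b + r)\<^sup>2))"
  shows "(N\<^sup>2 - r ^ 4)\<^sup>2 \<le> P" and "P \<le> (N\<^sup>2 + r ^ 4)\<^sup>2"
proof -
  have "P = (N\<^sup>2 - r ^ 4)\<^sup>2 + 4 * r ^ 4 * (2 * a * b)\<^sup>2"
    unfolding P_def N_def by algebra
  then show "(N\<^sup>2 - r ^ 4)\<^sup>2 \<le> P" by simp
  have "P = (N\<^sup>2 + r ^ 4)\<^sup>2 - 4 * r ^ 4 * (a\<^sup>2 - b\<^sup>2)\<^sup>2"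
    unfolding P_def N_def by algebra
  then show "P \<le> (N\<^sup>2 + r ^ 4)\<^sup>2" by simp
qed

lemma ln_norm_plane: "ln (norm (p :: plane)) = ln ((fst p)\<^sup>2 + (snd p)\<^sup>2) / 2"
  by (cases p) (simp add: norm_Pair ln_sqrt)

text \<open>The four logarithms add up to half the logarithm of the product \<open>P\<close>, and
  the centre contributes \<open>ln (N\<^sup>2)\<close> with \<open>N\<close> the squared norm of
  \<open>p\<close>. Since \<open>P\<close> lies between the squares of
  \<open>N\<^sup>2 - r ^ 4\<close> and \<open>N\<^sup>2 + r ^ 4\<close>, the second-order terms
  cancel and only order \<open>r ^ 4\<close> remains.\<close>

lemma ln_four_point_bound:
  fixes p :: plane
  assumes "0 < r" "r \<le> R / 2" "R \<le> norm p"
  shows "\<bar>ln (norm (p - (r, 0))) + ln (norm (p + (r, 0))) + ln (norm (p - (0, r))) + ln (norm (p + (0, r)))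
          - 4 * ln (norm p)\<bar> \<le> 2 * r ^ 4 / R ^ 4"
proof -
  obtain a b where p: "p = (a, b)" by fastforce
  define N where "N = a\<^sup>2 + b\<^sup>2"
  define P where "P = ((a - r)\<^sup>2 + b\<^sup>2) * ((a + r)\<^sup>2 + b\<^sup>2) * ((a\<^sup>2 + (b - r)\<^sup>2) * (a\<^sup>2 + (b + r)\<^sup>2))"
  have "R > 0" using assms by simp
  have "N = (norm p)\<^sup>2" by (simp add: N_def p norm_Pair)
  then have N2: "N\<^sup>2 = norm p ^ 4" by simp
  have R4: "R ^ 4 \<le> N\<^sup>2"
    unfolding N2 using assms \<open>R > 0\<close> by (intro power_mono) auto
  have "r ^ 4 \<le> (R / 2) ^ 4" using assms by (intro power_mono) auto
  then have "r ^ 4 \<le> R ^ 4 / 16" by (simp add: power_divide)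
  moreover have "0 \<le> r ^ 4" by simp
  ultimately have r4: "r ^ 4 \<le> R ^ 4 / 2" by linarith
  have "N > 0" using \<open>N = (norm p)\<^sup>2\<close> assms \<open>R > 0\<close> by auto
  have "R ^ 4 > 0" "r ^ 4 > 0" using \<open>R > 0\<close> assms by auto
  \<comment> \<open>This gives the common denominator \<open>R ^ 4 / 2\<close> for the upper and the
    lower estimate.\<close>
  have pos: "N\<^sup>2 - r ^ 4 \<ge> R ^ 4 / 2" using R4 r4 by simp
  then have pos': "N\<^sup>2 - r ^ 4 > 0" using \<open>R ^ 4 > 0\<close> by linarith
  have P: "(N\<^sup>2 - r ^ 4)\<^sup>2 \<le> P" "P \<le> (N\<^sup>2 + r ^ 4)\<^sup>2"
    unfolding N_def P_def by (rule four_point_product_bounds)+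
  then have "P > 0" using pos' by (smt (verit) zero_less_power)
  then have ne: "(a - r)\<^sup>2 + b\<^sup>2 > 0" "(a + r)\<^sup>2 + b\<^sup>2 > 0" "a\<^sup>2 + (b - r)\<^sup>2 > 0" "a\<^sup>2 + (b + r)\<^sup>2 > 0"
    unfolding P_def by (auto simp: zero_less_mult_iff sum_power2_gt_zero_iff not_sum_power2_lt_zero)
  define T where "T = ln (norm (p - (r, 0))) + ln (norm (p + (r, 0))) + ln (norm (p - (0, r))) + ln (norm (p + (0, r)))
          - 4 * ln (norm p)"
  have "T = (ln P) / 2 - ln (N\<^sup>2)"
  proof -
    have "ln P = ln ((a - r)\<^sup>2 + b\<^sup>2) + ln ((a + r)\<^sup>2 + b\<^sup>2) + (ln (a\<^sup>2 + (b - r)\<^sup>2) + ln (a\<^sup>2 + (b + r)\<^sup>2))"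
      unfolding P_def using ne by (simp only: ln_mult_pos mult_pos_pos)
    moreover have "ln (N\<^sup>2) = 2 * ln (a\<^sup>2 + b\<^sup>2)"
      using \<open>N > 0\<close> by (simp add: ln_realpow N_def)
    ultimately show ?thesis
      unfolding T_def ln_norm_plane by (simp add: p)
  qed
  moreover have "ln P \<le> 2 * ln (N\<^sup>2 + r ^ 4)"
  proof -
    have "ln P \<le> ln ((N\<^sup>2 + r ^ 4)\<^sup>2)"
      using P(2) \<open>P > 0\<close> ln_le_cancel_iff[of P "(N\<^sup>2 + r ^ 4)\<^sup>2"] by linarith
    then show ?thesis using pos' \<open>r ^ 4 > 0\<close> by (simp add: ln_realpow)
  qed
  moreover have "2 * ln (N\<^sup>2 - r ^ 4) \<le> ln P"
  proof -
    have "ln ((N\<^sup>2 - r ^ 4)\<^sup>2) \<le> ln P"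
      using P(1) \<open>P > 0\<close> zero_less_power[OF pos', of 2] ln_le_cancel_iff[of "(N\<^sup>2 - r ^ 4)\<^sup>2" P] by linarith
    then show ?thesis using pos' by (simp add: ln_realpow)
  qed
  moreover have "ln (N\<^sup>2 + r ^ 4) - ln (N\<^sup>2) \<le> r ^ 4 / N\<^sup>2"
    using ln_diff_le[of "N\<^sup>2 + r ^ 4" "N\<^sup>2"] \<open>N > 0\<close> \<open>r ^ 4 > 0\<close> by (simp add: add_pos_pos)
  moreover have "r ^ 4 / N\<^sup>2 \<le> r ^ 4 / (R ^ 4 / 2)"
  proof (rule divide_left_mono)
    show "R ^ 4 / 2 \<le> N\<^sup>2" using R4 \<open>R ^ 4 > 0\<close> by linarith
    show "0 < N\<^sup>2 * (R ^ 4 / 2)" using \<open>N > 0\<close> \<open>R ^ 4 > 0\<close> by simp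
  qed simp
  moreover have "ln (N\<^sup>2) - ln (N\<^sup>2 - r ^ 4) \<le> r ^ 4 / (N\<^sup>2 - r ^ 4)"
    using ln_diff_le[of "N\<^sup>2" "N\<^sup>2 - r ^ 4"] \<open>N > 0\<close> pos' by simp
  moreover have "r ^ 4 / (N\<^sup>2 - r ^ 4) \<le> r ^ 4 / (R ^ 4 / 2)"
  proof (rule divide_left_mono)
    show "R ^ 4 / 2 \<le> N\<^sup>2 - r ^ 4" by (rule pos)
    show "0 < (N\<^sup>2 - r ^ 4) * (R ^ 4 / 2)" using pos' \<open>R ^ 4 > 0\<close> by simp
  qed simp
  ultimately have "\<bar>T\<bar> \<le> r ^ 4 / (R ^ 4 / 2)" by linarith
  then show ?thesis by (simp add: T_def mult.commute)
qed

text \<open>The height of \<open>x\<close> grows at most linearly in the distance to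
  \<open>y\<close>, and \<open>ln (1 + t) \<le> t\<close> gains the square of that distance. This is
  the decay at infinity for a fixed pole.\<close>

lemma half_plane_green_le_inverse_dist:
  assumes "0 < snd x" "0 < snd y" "1 \<le> norm (x - y)"
  shows "half_plane_green x y \<le> (1 + norm y) * norm y / norm (x - y)"
proof -
  define \<rho> where "\<rho> = norm (x - y)"
  have "\<rho> \<ge> 1" using assms by (simp add: \<rho>_def)
  have y: "snd y \<le> norm y" by (cases y) (simp add: norm_Pair real_le_rsqrt)
  have "snd x \<le> norm x" by (cases x) (simp add: norm_Pair real_le_rsqrt)
  also have "norm x \<le> \<rho> + norm y" using norm_triangle_ineq[of "x - y" y] by (simp add: \<rho>_def)
  also have "\<dots> \<le> \<rho> * (1 + norm y)" using mult_right_mono[OF \<open>\<rho> \<ge> 1\<close>, of "norm y"] by (simp add: algebra_simps)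
  finally have x: "snd x \<le> \<rho> * (1 + norm y)" .
  have "ln (1 + 4 * snd x * snd y / \<rho>\<^sup>2) \<le> 4 * snd x * snd y / \<rho>\<^sup>2"
    using assms by (intro ln_add_one_self_le_self) (simp add: zero_le_divide_iff)
  then have "half_plane_green x y \<le> 1 / (4 * pi) * (4 * snd x * snd y / \<rho>\<^sup>2)"
    unfolding half_plane_green_def \<rho>_def by (intro mult_left_mono) auto
  also have "\<dots> = snd x * snd y / \<rho>\<^sup>2 / pi" by simp
  also have "\<dots> \<le> snd x * snd y / \<rho>\<^sup>2 / 1"
    using pi_ge_two assms by (intro divide_left_mono) auto
  also have "\<dots> \<le> (\<rho> * (1 + norm y)) * norm y / \<rho>\<^sup>2 / 1"
    using x y assms by (intro divide_right_mono mult_mono) auto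
  also have "\<dots> = (1 + norm y) * norm y / \<rho>" by (simp add: power2_eq_square)
  finally show ?thesis by (simp add: \<rho>_def)
qed

section \<open>The regular part of the Green function and its dependence on the pole\<close>

locale green_domain =
  fixes \<Omega> :: "plane set" and G :: "plane \<Rightarrow> plane \<Rightarrow> real"
  assumes open_domain: "open \<Omega>" and domain_upper: "\<Omega> \<subseteq> upper_half_plane"
    and green: "green_function \<Omega> G"
begin

text \<open>On \<open>\<Omega>\<close> the choice is unique: \<open>G\<close> determines the
  function away from the pole, and continuity determines it at the pole. Unlike \<open>G\<close>, it
  has a meaningful value on the diagonal.\<close>

definition regular_part :: "plane \<Rightarrow> plane \<Rightarrow> real" where
  "regular_part y = (SOME h. harmonic_on \<Omega> h \<and> (\<forall>x\<in>\<Omega> - {y}. G x y = - ln (norm (x - y)) / (2 * pi) + h x))"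

lemma
  assumes "y \<in> \<Omega>"
  shows regular_part_harmonic: "harmonic_on \<Omega> (regular_part y)"
    and green_eq_regular_part: "x \<in> \<Omega> \<Longrightarrow> x \<noteq> y \<Longrightarrow> G x y = - ln (norm (x - y)) / (2 * pi) + regular_part y x"
proof -
  have "\<exists>h. harmonic_on \<Omega> h \<and> (\<forall>x\<in>\<Omega> - {y}. G x y = - ln (norm (x - y)) / (2 * pi) + h x)"
    using green assms unfolding green_function_def by blast
  from someI_ex[OF this, folded regular_part_def] show "harmonic_on \<Omega> (regular_part y)"
    "x \<in> \<Omega> \<Longrightarrow> x \<noteq> y \<Longrightarrow> G x y = - ln (norm (x - y)) / (2 * pi) + regular_part y x"
    by auto
qed

lemma green_nonneg: "x \<in> \<Omega> \<Longrightarrow> y \<in> \<Omega> \<Longrightarrow> x \<noteq> y \<Longrightarrow> 0 \<le> G x y"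
  and green_le: "x \<in> \<Omega> \<Longrightarrow> y \<in> \<Omega> \<Longrightarrow> x \<noteq> y \<Longrightarrow> G x y \<le> half_plane_green x y"
  and green_frontier: "y \<in> \<Omega> \<Longrightarrow> z \<in> frontier \<Omega> \<Longrightarrow> ((\<lambda>x. G x y) \<longlongrightarrow> 0) (at z within \<Omega>)"
  using green unfolding green_function_def by auto

lemma snd_pos: "x \<in> \<Omega> \<Longrightarrow> 0 < snd x"
  using domain_upper by (auto simp: upper_half_plane_def)

text \<open>The boundary condition and the decay of the half plane kernel feed
  \<open>compact_superlevel\<close>. The pole is put into \<open>C\<close> because the value
  \<open>G y y\<close> is unspecified.\<close>

lemma green_vanishes:
  assumes "y \<in> \<Omega>" "e > 0"
  shows "\<exists>C. compact C \<and> C \<subseteq> \<Omega> \<and> y \<in> C \<and> (\<forall>x\<in>\<Omega> - C. G x y < e)"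
proof -
  define K where "K = (1 + norm y) * norm y"
  have "K \<ge> 0" by (simp add: K_def)
  have inf: "G x y < e" if "x \<in> \<Omega>" "norm y + 1 + K / e < norm x" for x
  proof -
    have "norm x \<le> norm (x - y) + norm y" using norm_triangle_ineq[of "x - y" y] by simp
    then have \<rho>: "1 + K / e < norm (x - y)" using that by simp
    have "K / e \<ge> 0" using \<open>K \<ge> 0\<close> \<open>e > 0\<close> by simp
    then have \<rho>1: "norm (x - y) \<ge> 1" using \<rho> by linarith
    then have "x \<noteq> y" by auto
    then have "G x y \<le> half_plane_green x y" using green_le that assms by simp
    also have "\<dots> \<le> K / norm (x - y)"
      unfolding K_def using half_plane_green_le_inverse_dist[of x y] snd_pos that assms \<rho>1 by simp
    also have "\<dots> < e"
    proof -
      have "K / e < norm (x - y)" using \<rho> by linarith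
      moreover have "norm (x - y) > 0" using \<rho>1 by linarith
      ultimately show ?thesis using \<open>e > 0\<close> by (simp add: divide_simps mult.commute)
    qed
    finally show ?thesis .
  qed
  have fr: "eventually (\<lambda>x. G x y < e) (at z within \<Omega>)" if "z \<in> frontier \<Omega>" for z
    using order_tendstoD(2)[OF green_frontier[OF assms(1) that] assms(2)] .
  from compact_superlevel[OF open_domain fr inf]
  obtain C where "compact C" "C \<subseteq> \<Omega>" "\<forall>x\<in>\<Omega> - C. G x y < e"
    by blast
  then show ?thesis
    using assms by (intro exI[of _ "insert y C"]) (simp add: compact_insert)
qed

text \<open>Near the boundary and at infinity every \<open>G x z\<close> is small, so the
  combination of regular parts is close to that of the logarithms divided by \<open>2 * pi\<close>,
  which is at most \<open>B\<close>. The maximum principle carries the bound to all of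
  \<open>\<Omega>\<close>, including the ball that contains the poles.\<close>

lemma regular_part_combination_le:
  assumes R: "cball y R \<subseteq> \<Omega>" and z: "\<And>c z. (c, z) \<in> set cs \<Longrightarrow> z \<in> cball y R"
    and B: "\<And>x. x \<in> \<Omega> - cball y R \<Longrightarrow> (\<Sum>(c, z)\<leftarrow>cs. c * ln (norm (x - z))) \<le> 2 * pi * B"
    and "x \<in> \<Omega>"
  shows "(\<Sum>(c, z)\<leftarrow>cs. c * regular_part z x) \<le> B"
proof -
  have z\<Omega>: "z \<in> \<Omega>" if "(c, z) \<in> set cs" for c z using z[OF that] R by blast
  show ?thesis
  proof (rule maximum_principle[OF open_domain _ _ _ \<open>x \<in> \<Omega>\<close>])
    show "continuous_on \<Omega> (\<lambda>x. \<Sum>(c, z)\<leftarrow>cs. c * regular_part z x)"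
      by (intro continuous_on_sum_list harmonic_on_continuous_on regular_part_harmonic z\<Omega>)
    show "laplace_null_at (\<lambda>x. \<Sum>(c, z)\<leftarrow>cs. c * regular_part z x) w" if "w \<in> \<Omega>" for w
      by (intro laplace_null_at_sum_list harmonic_on_laplace_null[OF _ open_domain that] regular_part_harmonic z\<Omega>)
    fix e :: real assume "e > 0"
    define s where "s = (\<Sum>(c, z)\<leftarrow>cs. \<bar>c\<bar>)"
    have "s \<ge> 0" unfolding s_def by (intro sum_list_nonneg) auto
    \<comment> \<open>The Green functions contribute at most \<open>s * e'\<close> in total, which
      is less than \<open>e\<close>, also when \<open>s = 0\<close>.\<close>
    define e' where "e' = e / (s + 1)"
    have "e' > 0" using \<open>e > 0\<close> \<open>s \<ge> 0\<close> by (simp add: e'_def)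
    have "\<forall>p\<in>set cs. \<exists>C. compact C \<and> C \<subseteq> \<Omega> \<and> snd p \<in> C \<and> (\<forall>x\<in>\<Omega> - C. G x (snd p) < e')"
      using z\<Omega> by (intro ballI green_vanishes \<open>e' > 0\<close>) force
    then have "\<forall>z\<in>snd ` set cs. \<exists>C. compact C \<and> C \<subseteq> \<Omega> \<and> z \<in> C \<and> (\<forall>x\<in>\<Omega> - C. G x z < e')"
      by blast
    from bchoice[OF this] obtain D where
      "\<forall>z\<in>snd ` set cs. compact (D z) \<and> D z \<subseteq> \<Omega> \<and> z \<in> D z \<and> (\<forall>x\<in>\<Omega> - D z. G x z < e')" ..
    then have D: "\<And>c z. (c, z) \<in> set cs \<Longrightarrow> compact (D z) \<and> D z \<subseteq> \<Omega> \<and> z \<in> D z \<and> (\<forall>x\<in>\<Omega> - D z. G x z < e')"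
      by force
    \<comment> \<open>With the ball in \<open>C\<close>, only points where \<open>B\<close> applies
      remain; with each pole in its \<open>D z\<close>, the decomposition of \<open>G x z\<close> is
      available there.\<close>
    define C where "C = cball y R \<union> (\<Union>p\<in>set cs. D (snd p))"
    have "compact C" unfolding C_def using D by (intro compact_Un compact_UN) auto
    moreover have "C \<subseteq> \<Omega>" unfolding C_def using D R by force
    moreover have "(\<Sum>(c, z)\<leftarrow>cs. c * regular_part z x) < B + e" if x: "x \<in> \<Omega> - C" for x
    proof -
      have *: "c * regular_part z x \<le> \<bar>c\<bar> * e' + 1 / (2 * pi) * (c * ln (norm (x - z)))" if "(c, z) \<in> set cs" for c z
      proof -
        have "D (snd (c, z)) \<subseteq> C" using that unfolding C_def by blast
        then have "x \<in> \<Omega> - D z" using x by auto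
        then have "x \<noteq> z" "G x z < e'" using D[OF that] by blast+
        moreover have "0 \<le> G x z" using green_nonneg[OF _ z\<Omega>[OF that] \<open>x \<noteq> z\<close>] x by blast
        ultimately have "\<bar>G x z\<bar> \<le> e'" by simp
        then have "c * G x z \<le> \<bar>c\<bar> * e'"
          using mult_left_mono[of "\<bar>G x z\<bar>" e' "\<bar>c\<bar>"] abs_ge_self[of "c * G x z"] by (simp add: abs_mult)
        moreover have "regular_part z x = G x z + ln (norm (x - z)) / (2 * pi)"
          using green_eq_regular_part[OF z\<Omega>[OF that]] x \<open>x \<noteq> z\<close> by simp
        ultimately show ?thesis by (simp add: algebra_simps)
      qed
      have "(\<Sum>(c, z)\<leftarrow>cs. c * regular_part z x) \<le> (\<Sum>(c, z)\<leftarrow>cs. \<bar>c\<bar> * e' + 1 / (2 * pi) * (c * ln (norm (x - z))))"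
        using * by (intro sum_list_mono) auto
      also have "\<dots> = s * e' + 1 / (2 * pi) * (\<Sum>(c, z)\<leftarrow>cs. c * ln (norm (x - z)))"
        unfolding s_def
        by (induction cs) (auto simp: algebra_simps add_divide_distrib)
      also have "\<dots> \<le> s * e' + 1 / (2 * pi) * (2 * pi * B)"
        using B[of x] x by (intro add_left_mono mult_left_mono) (auto simp: C_def)
      also have "\<dots> < B + e"
        using \<open>e > 0\<close> \<open>s \<ge> 0\<close> by (simp add: e'_def field_simps)
      finally show ?thesis .
    qed
    ultimately show "\<exists>C. compact C \<and> C \<subseteq> \<Omega> \<and> (\<forall>x\<in>\<Omega> - C. (\<Sum>(c, z)\<leftarrow>cs. c * regular_part z x) < B + e)"
      by blast
  qed
qed

lemma regular_part_combination_abs_le: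
  assumes R: "cball y R \<subseteq> \<Omega>" and z: "\<And>c z. (c, z) \<in> set cs \<Longrightarrow> z \<in> cball y R"
    and B: "\<And>x. x \<in> \<Omega> - cball y R \<Longrightarrow> \<bar>\<Sum>(c, z)\<leftarrow>cs. c * ln (norm (x - z))\<bar> \<le> 2 * pi * B"
    and "x \<in> \<Omega>"
  shows "\<bar>\<Sum>(c, z)\<leftarrow>cs. c * regular_part z x\<bar> \<le> B"
proof -
  have neg: "(\<Sum>(c, z)\<leftarrow>map (\<lambda>(c, z). (- c, z)) cs. c * f z) = - (\<Sum>(c, z)\<leftarrow>cs. c * f z)" for f :: "plane \<Rightarrow> real"
    by (induction cs) auto
  have "(\<Sum>(c, z)\<leftarrow>cs. c * regular_part z x) \<le> B"
    using B by (intro regular_part_combination_le[OF R z _ \<open>x \<in> \<Omega>\<close>]) (auto simp: abs_le_iff)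
  moreover have "(\<Sum>(c, z)\<leftarrow>map (\<lambda>(c, z). (- c, z)) cs. c * regular_part z x) \<le> B"
  proof (rule regular_part_combination_le[OF R _ _ \<open>x \<in> \<Omega>\<close>])
    show "z \<in> cball y R" if "(c, z) \<in> set (map (\<lambda>(c, z). (- c, z)) cs)" for c z
      using that z by auto
    show "(\<Sum>(c, z)\<leftarrow>map (\<lambda>(c, z). (- c, z)) cs. c * ln (norm (x - z))) \<le> 2 * pi * B" if "x \<in> \<Omega> - cball y R" for x
      unfolding neg using B[OF that] by linarith
  qed
  ultimately show ?thesis unfolding neg by linarith
qed

text \<open>Outside the ball both distances are at least \<open>R / 2\<close>, so moving the pole
  changes the logarithm by at most \<open>2 * dist z y / R\<close>. The estimate is uniform in
  \<open>x\<close>, which is what joint continuity requires.\<close>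

lemma regular_part_pole_lipschitz:
  assumes "R > 0" "cball y R \<subseteq> \<Omega>" "dist z y \<le> R / 2" "x \<in> \<Omega>"
  shows "\<bar>regular_part z x - regular_part y x\<bar> \<le> dist z y / R"
proof -
  have "\<bar>\<Sum>(c, z)\<leftarrow>[(1, z), (- 1, y)]. c * regular_part z x\<bar> \<le> dist z y / R"
  proof (rule regular_part_combination_abs_le[OF assms(2) _ _ assms(4)])
    show "\<And>c w. (c, w) \<in> set [(1::real, z), (- 1, y)] \<Longrightarrow> w \<in> cball y R"
      using assms by (auto simp: dist_commute)
    fix w assume "w \<in> \<Omega> - cball y R"
    then have w: "norm (w - y) > R" by (simp add: dist_norm norm_minus_commute)
    have tri: "\<bar>norm (w - z) - norm (w - y)\<bar> \<le> dist z y"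
      using norm_triangle_ineq3[of "w - z" "w - y"] by (simp add: dist_norm norm_minus_commute)
    then have w': "norm (w - z) \<ge> R / 2" using w assms by linarith
    have "ln (norm (w - z)) - ln (norm (w - y)) \<le> (norm (w - z) - norm (w - y)) / norm (w - y)"
      using w w' assms by (intro ln_diff_le) auto
    also have "\<dots> \<le> dist z y / norm (w - y)" using tri by (intro divide_right_mono) auto
    also have "\<dots> \<le> dist z y / (R / 2)"
      using w assms by (intro divide_left_mono mult_pos_pos) auto
    finally have 1: "ln (norm (w - z)) - ln (norm (w - y)) \<le> dist z y / (R / 2)" .
    have "ln (norm (w - y)) - ln (norm (w - z)) \<le> (norm (w - y) - norm (w - z)) / norm (w - z)"
      using w w' assms by (intro ln_diff_le) auto
    also have "\<dots> \<le> dist z y / norm (w - z)" using tri by (intro divide_right_mono) auto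
    also have "\<dots> \<le> dist z y / (R / 2)"
      using w' assms by (intro divide_left_mono mult_pos_pos) auto
    finally have "\<bar>ln (norm (w - z)) - ln (norm (w - y))\<bar> \<le> 2 * (dist z y / R)" using 1 by (simp add: abs_le_iff mult.commute)
    also have "\<dots> \<le> 2 * pi * (dist z y / R)"
      using pi_ge_two assms by (intro mult_right_mono) auto
    finally show "\<bar>\<Sum>(c, z)\<leftarrow>[(1, z), (- 1, y)]. c * ln (norm (w - z))\<bar> \<le> 2 * pi * (dist z y / R)" by simp
  qed
  then show ?thesis by simp
qed

text \<open>The stencil acts on the pole. Its effect on the logarithm outside the ball is of order
  \<open>r ^ 4\<close>, hence so is its effect on the regular part throughout
  \<open>\<Omega>\<close>; dividing by \<open>r\<^sup>2\<close> still leaves a null limit. No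
  derivative with respect to the pole is taken.\<close>

lemma regular_part_pole_laplace_null:
  assumes "x \<in> \<Omega>" "y \<in> \<Omega>"
  shows "laplace_null_at (\<lambda>z. regular_part z x) y"
proof -
  obtain R where R: "R > 0" "cball y R \<subseteq> \<Omega>"
    using open_domain assms open_contains_cball by blast
  have bound: "\<bar>discrete_laplacian (\<lambda>z. regular_part z x) y r\<bar> \<le> r ^ 4 / R ^ 4" if r: "0 < r" "r \<le> R / 2" for r
  proof -
    let ?cs = "[(1, y + (r, 0)), (1, y - (r, 0)), (1, y + (0, r)), (1, y - (0, r)), (- 4::real, y)]"
    have "\<bar>\<Sum>(c, z)\<leftarrow>?cs. c * regular_part z x\<bar> \<le> r ^ 4 / R ^ 4"
    proof (rule regular_part_combination_abs_le[OF R(2) _ _ assms(1)])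
      show "\<And>c z. (c, z) \<in> set ?cs \<Longrightarrow> z \<in> cball y R"
        using r by (auto simp: dist_norm norm_Pair)
      fix w assume "w \<in> \<Omega> - cball y R"
      then have w: "R \<le> norm (w - y)" by (simp add: dist_norm norm_minus_commute)
      have "(\<Sum>(c, z)\<leftarrow>?cs. c * ln (norm (w - z))) =
        ln (norm ((w - y) - (r, 0))) + ln (norm ((w - y) + (r, 0))) + ln (norm ((w - y) - (0, r))) + ln (norm ((w - y) + (0, r)))
          - 4 * ln (norm (w - y))" by (simp add: algebra_simps)
      then have "\<bar>\<Sum>(c, z)\<leftarrow>?cs. c * ln (norm (w - z))\<bar> \<le> 2 * r ^ 4 / R ^ 4"
        using ln_four_point_bound[OF r w] by simp
      also have "\<dots> = 2 * (r ^ 4 / R ^ 4)" by simp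
      also have "\<dots> \<le> 2 * pi * (r ^ 4 / R ^ 4)"
        using pi_ge_two R by (intro mult_right_mono) auto
      finally show "\<bar>\<Sum>(c, z)\<leftarrow>?cs. c * ln (norm (w - z))\<bar> \<le> 2 * pi * (r ^ 4 / R ^ 4)" .
    qed
    then show ?thesis by (simp add: discrete_laplacian_def algebra_simps)
  qed
  show ?thesis
    unfolding laplace_null_at_def
  proof (rule Lim_null_comparison)
    have "eventually (\<lambda>r. 0 < r \<and> r < R / 2) (at_right 0)"
      unfolding eventually_at_right_field using R by (intro exI[of _ "R / 2"]) auto
    then show "eventually (\<lambda>r. norm (discrete_laplacian (\<lambda>z. regular_part z x) y r / r\<^sup>2) \<le> r\<^sup>2 / R ^ 4) (at_right 0)"
    proof (rule eventually_mono)
      fix r assume r: "0 < r \<and> r < R / 2"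
      then have "\<bar>discrete_laplacian (\<lambda>z. regular_part z x) y r\<bar> / r\<^sup>2 \<le> r ^ 4 / R ^ 4 / r\<^sup>2"
        using bound[of r] by (intro divide_right_mono) auto
      also have "\<dots> = r\<^sup>2 / R ^ 4" using r by (simp add: power2_eq_square power4_eq_xxxx)
      finally show "norm (discrete_laplacian (\<lambda>z. regular_part z x) y r / r\<^sup>2) \<le> r\<^sup>2 / R ^ 4" by simp
    qed
    show "((\<lambda>r. r\<^sup>2 / R ^ 4) \<longlongrightarrow> 0) (at_right 0)"
      using R by (auto intro!: tendsto_eq_intros)
  qed
qed

text \<open>Continuity in the first variable for a fixed pole combines with the Lipschitz bound in
  the pole, which is uniform in the first variable.\<close>

lemma regular_part_jointly_continuous: "continuous_on (\<Omega> \<times> \<Omega>) (\<lambda>p. regular_part (snd p) (fst p))"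
proof (rule continuous_at_imp_continuous_on)
  show "\<forall>p\<in>\<Omega> \<times> \<Omega>. isCont (\<lambda>p. regular_part (snd p) (fst p)) p"
  proof
    fix p assume "p \<in> \<Omega> \<times> \<Omega>"
    then obtain x y where p: "p = (x, y)" "x \<in> \<Omega>" "y \<in> \<Omega>" by auto
    obtain R where R: "R > 0" "cball y R \<subseteq> \<Omega>"
      using open_domain p open_contains_cball by blast
    have nhds: "eventually (\<lambda>q. fst q \<in> \<Omega> \<and> dist (snd q) y \<le> R / 2) (at p)"
    proof -
      have "open (\<Omega> \<times> ball y (R / 2))" by (intro open_Times open_domain open_ball)
      moreover have "p \<in> \<Omega> \<times> ball y (R / 2)" using p R by auto
      ultimately have "eventually (\<lambda>q. q \<in> \<Omega> \<times> ball y (R / 2)) (at p)"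
        by (rule eventually_at_in_open')
      then show ?thesis by (rule eventually_mono) (auto simp: dist_commute)
    qed
    have lim_fst: "(fst \<longlongrightarrow> x) (at p)" and lim_snd: "(snd \<longlongrightarrow> y) (at p)"
      using p by (auto intro!: tendsto_eq_intros)
    have "isCont (regular_part y) x"
      using harmonic_on_continuous_on[OF regular_part_harmonic[OF p(3)]] p(2) open_domain
      by (simp add: continuous_on_eq_continuous_at)
    then have "((\<lambda>q. regular_part y (fst q)) \<longlongrightarrow> regular_part y x) (at p)"
      using lim_fst by (rule isCont_tendsto_compose)
    moreover have "((\<lambda>q. regular_part (snd q) (fst q) - regular_part y (fst q)) \<longlongrightarrow> 0) (at p)"
    proof (rule Lim_null_comparison)
      show "eventually (\<lambda>q. norm (regular_part (snd q) (fst q) - regular_part y (fst q)) \<le> dist (snd q) y / R) (at p)"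
        using nhds by (rule eventually_mono) (use regular_part_pole_lipschitz[OF R] in auto)
      show "((\<lambda>q. dist (snd q) y / R) \<longlongrightarrow> 0) (at p)"
        using tendsto_divide[OF tendsto_dist[OF lim_snd tendsto_const, of y] tendsto_const, of R] R by simp
    qed
    ultimately have "((\<lambda>q. regular_part y (fst q) + (regular_part (snd q) (fst q) - regular_part y (fst q))) \<longlongrightarrow> regular_part y x + 0) (at p)"
      by (intro tendsto_add)
    then show "isCont (\<lambda>p. regular_part (snd p) (fst p)) p"
      by (simp add: isCont_def p)
  qed
qed

text \<open>Passing to regular parts removes the singularity at \<open>y = x\<close>, while off the
  diagonal the logarithms cancel in the difference. One inequality suffices, since \<open>x\<close>
  and \<open>y\<close> can be exchanged.\<close>

lemma regular_part_symmetric: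
  assumes "x \<in> \<Omega>" "y \<in> \<Omega>"
  shows "regular_part x y = regular_part y x"
proof -
  have le: "regular_part x y \<le> regular_part y x" if x: "x \<in> \<Omega>" and y: "y \<in> \<Omega>" for x y
  proof -
    \<comment> \<open>\<open>G y x - G x y \<le> G y x\<close> already tends to zero at the boundary, whatever \<open>G x\<close> does there.\<close>
    have "regular_part x y - regular_part y x \<le> 0"
    proof (rule maximum_principle[OF open_domain _ _ _ y, of "\<lambda>y. regular_part x y - regular_part y x"])
      have "continuous_on \<Omega> (\<lambda>y. regular_part y x)"
        using x by (intro continuous_on_compose2[OF regular_part_jointly_continuous, of _ "\<lambda>y. (x, y)", simplified] continuous_intros) auto
      with harmonic_on_continuous_on[OF regular_part_harmonic[OF x]]
      show "continuous_on \<Omega> (\<lambda>y. regular_part x y - regular_part y x)"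
        by (rule continuous_on_diff)
      show "laplace_null_at (\<lambda>y. regular_part x y - regular_part y x) w" if "w \<in> \<Omega>" for w
        by (intro laplace_null_at_diff regular_part_pole_laplace_null x that harmonic_on_laplace_null[OF regular_part_harmonic[OF x] open_domain])
      fix e :: real assume "e > 0"
      then obtain C where C: "compact C" "C \<subseteq> \<Omega>" "x \<in> C" "\<forall>y\<in>\<Omega> - C. G y x < e"
        using green_vanishes[OF x] by blast
      have "regular_part x w - regular_part w x < 0 + e" if w: "w \<in> \<Omega> - C" for w
      proof -
        have "w \<noteq> x" using w C by auto
        then have "regular_part x w - regular_part w x = G w x - G x w"
          using green_eq_regular_part[OF x, of w] green_eq_regular_part[of w x] w x by (simp add: norm_minus_commute)
        also have "\<dots> < e" using green_nonneg[of x w] \<open>w \<noteq> x\<close> w x C(4) by force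
        finally show ?thesis by simp
      qed
      then show "\<exists>C. compact C \<and> C \<subseteq> \<Omega> \<and> (\<forall>w\<in>\<Omega> - C. regular_part x w - regular_part w x < 0 + e)"
        using C by blast
    qed
    then show ?thesis by simp
  qed
  show ?thesis using le assms by (intro antisym)
qed

lemma green_symmetric:
  assumes "x \<in> \<Omega>" "y \<in> \<Omega>"
  shows "G x y = G y x"
  using green_eq_regular_part[of y x] green_eq_regular_part[of x y] regular_part_symmetric[of x y] assms
  by (cases "x = y") (auto simp: norm_minus_commute)

end

subsection \<open>Stream functions and the energy\<close>

definition log_kernel :: "plane \<Rightarrow> real" where
  "log_kernel z = max 0 (- ln (norm z))"

lemma log_kernel_nonneg: "0 \<le> log_kernel z"
  by (simp add: log_kernel_def)

lemma log_kernel_minus: "log_kernel (x - y) = log_kernel (y - x)"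
  by (simp add: log_kernel_def norm_minus_commute)

text \<open>This separates the local singularity from the growth: \<open>1 + t\<close> is at most
  the product of \<open>1 + 2 * snd x\<close> and \<open>1 + 2 * snd y\<close>, whose logarithms are
  linear in the heights. Growth linear in the height is what a finite impulse controls.\<close>

lemma half_plane_green_le_log_kernel:
  assumes "0 < snd x" "0 < snd y" "x \<noteq> y"
  shows "half_plane_green x y \<le> snd x + snd y + log_kernel (x - y)"
proof -
  define d t where "d = norm (x - y)" and "t = 4 * snd x * snd y"
  have "d > 0" "t > 0" using assms by (auto simp: d_def t_def)
  have "ln (1 + t / d\<^sup>2) \<le> ln (1 + t) + 2 * log_kernel (x - y)"
  proof (cases "d \<ge> 1")
    case True
    then have "d\<^sup>2 \<ge> 1" by simp
    then have "t / d\<^sup>2 \<le> t" using \<open>t > 0\<close> by (simp add: divide_simps)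
    then have "ln (1 + t / d\<^sup>2) \<le> ln (1 + t)"
      using \<open>t > 0\<close> \<open>d > 0\<close> by (simp add: add_pos_pos)
    then show ?thesis using log_kernel_nonneg[of "x - y"] by linarith
  next
    case False
    then have "d\<^sup>2 \<le> 1" using \<open>d > 0\<close> by (simp add: power_le_one)
    then have "1 + t / d\<^sup>2 \<le> (1 + t) / d\<^sup>2" using \<open>d > 0\<close> by (simp add: divide_simps)
    then have "ln (1 + t / d\<^sup>2) \<le> ln ((1 + t) / d\<^sup>2)"
      using \<open>t > 0\<close> \<open>d > 0\<close> by (subst ln_le_cancel_iff) (auto simp: add_pos_pos)
    also have "\<dots> = ln (1 + t) - 2 * ln d"
      using \<open>t > 0\<close> \<open>d > 0\<close> by (simp add: ln_div ln_realpow)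
    finally show ?thesis by (simp add: log_kernel_def d_def)
  qed
  also have "ln (1 + t) \<le> ln ((1 + 2 * snd x) * (1 + 2 * snd y))"
    using assms \<open>t > 0\<close> by (subst ln_le_cancel_iff) (auto simp: t_def algebra_simps intro!: add_pos_pos mult_pos_pos)
  also have "\<dots> = ln (1 + 2 * snd x) + ln (1 + 2 * snd y)"
    using assms by (simp add: ln_mult)
  also have "\<dots> \<le> 2 * snd x + 2 * snd y"
    using assms by (intro add_mono ln_add_one_self_le_self) auto
  finally have "ln (1 + t / d\<^sup>2) \<le> 2 * (snd x + snd y + log_kernel (x - y))" by simp
  then have "half_plane_green x y \<le> 1 / (4 * pi) * (2 * (snd x + snd y + log_kernel (x - y)))"
    unfolding half_plane_green_def d_def t_def by (intro mult_left_mono) auto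
  also have "\<dots> \<le> 1 / 2 * (2 * (snd x + snd y + log_kernel (x - y)))"
    using assms log_kernel_nonneg[of "x - y"] pi_ge_two
    by (intro mult_right_mono) (auto simp: divide_simps)
  finally show ?thesis by simp
qed

text \<open>A product of two such factors dominates the squared logarithm and reduces its
  integrability to one dimension. The value at 0 is 0, because \<open>0 powr a = 0\<close>.\<close>

definition inv_sqrt_kernel :: "real \<Rightarrow> real" where
  "inv_sqrt_kernel s = indicator {-1..1} s * (\<bar>s\<bar> powr (-1/2))"

lemma inv_sqrt_kernel_integrable: "integrable lborel inv_sqrt_kernel"
proof -
  define j :: "real \<Rightarrow> real" where "j s = indicator {0..1} s * (s powr (-1/2))" for s
  have [measurable]: "j \<in> borel_measurable borel" "inv_sqrt_kernel \<in> borel_measurable borel"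
    unfolding j_def inv_sqrt_kernel_def by measurable
  have "(\<lambda>s::real. s powr (-1/2)) integrable_on {0..1}"
    by (rule integrable_on_powr_from_0) auto
  then have "set_integrable lebesgue {0..1} (\<lambda>s::real. s powr (-1/2))"
    by (rule nonnegative_absolutely_integrable_1) auto
  then have "integrable lebesgue j" by (simp add: set_integrable_def j_def[abs_def])
  then have j: "integrable lborel j" by (simp add: integrable_completion)
  have j': "integrable lborel (\<lambda>s. j (- s))"
    using lborel_integrable_real_affine[OF j, of "-1" 0] by simp
  show ?thesis
  proof (rule Bochner_Integration.integrable_bound[OF Bochner_Integration.integrable_add[OF j j']])
    show "AE s in lborel. norm (inv_sqrt_kernel s) \<le> norm (j s + j (- s))"
      by (rule AE_I2) (auto simp: inv_sqrt_kernel_def j_def indicator_def)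
  qed simp
qed

lemma log_kernel_measurable[measurable]: "log_kernel \<in> borel_measurable borel"
  unfolding log_kernel_def by measurable

text \<open>For \<open>n = norm z < 1\<close>, \<open>- ln n\<close> is twice the logarithm of
  \<open>n powr (-1/2)\<close>, so its square is at most \<open>4 / n\<close>; the two factors of
  \<open>n powr (-1/2)\<close> are then bounded through one coordinate each. The axes are excluded
  because the right-hand side vanishes there by the convention for \<open>powr\<close>.\<close>

lemma log_kernel_sq_le:
  assumes "fst z \<noteq> 0" "snd z \<noteq> 0"
  shows "(log_kernel z)\<^sup>2 \<le> 4 * (inv_sqrt_kernel (fst z) * inv_sqrt_kernel (snd z))"
proof (cases "norm z < 1")
  case True
  obtain a b where z: "z = (a, b)" by fastforce
  have ab: "a \<noteq> 0" "b \<noteq> 0" using assms z by auto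
  define n where "n = norm z"
  have "n > 0" "n < 1" using True ab by (auto simp: n_def z zero_prod_def)
  have "\<bar>a\<bar> \<le> n" "\<bar>b\<bar> \<le> n" by (auto simp: n_def z norm_Pair intro: real_le_rsqrt)
  define s where "s = n powr (-1/2)"
  have "s > 0" using \<open>n > 0\<close> by (simp add: s_def)
  have "- ln n = 2 * ln s" using \<open>n > 0\<close> by (simp add: s_def ln_powr)
  moreover have "ln s \<le> s" using ln_bound[OF \<open>s > 0\<close>] .
  ultimately have le: "- ln n \<le> 2 * s" by simp
  have "0 \<le> - ln n" using \<open>n > 0\<close> \<open>n < 1\<close> by simp
  then have "(log_kernel z)\<^sup>2 = (- ln n)\<^sup>2" by (simp add: log_kernel_def n_def)
  also have "\<dots> \<le> (2 * s)\<^sup>2" using le \<open>0 \<le> - ln n\<close> by (intro power_mono)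
  also have "\<dots> = 4 * (s * s)" by (simp add: power2_eq_square)
  also have "s * s \<le> \<bar>a\<bar> powr (-1/2) * \<bar>b\<bar> powr (-1/2)"
    unfolding s_def using \<open>\<bar>a\<bar> \<le> n\<close> \<open>\<bar>b\<bar> \<le> n\<close> ab
    by (intro mult_mono powr_mono2') auto
  finally show ?thesis
    using \<open>\<bar>a\<bar> \<le> n\<close> \<open>\<bar>b\<bar> \<le> n\<close> \<open>n < 1\<close>
    by (simp add: z inv_sqrt_kernel_def abs_le_iff)
next
  case False
  then have "log_kernel z = 0" by (simp add: log_kernel_def)
  then show ?thesis by (simp add: inv_sqrt_kernel_def)
qed

lemma log_kernel_sq_integrable: "integrable lborel (\<lambda>z. (log_kernel z)\<^sup>2)"
proof -
  have [measurable]: "inv_sqrt_kernel \<in> borel_measurable borel"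
    unfolding inv_sqrt_kernel_def by measurable
  have nonneg: "inv_sqrt_kernel s \<ge> 0" for s by (simp add: inv_sqrt_kernel_def)
  define F where "F p = 4 * (inv_sqrt_kernel (fst p) * inv_sqrt_kernel (snd p))" for p :: plane
  have [measurable]: "F \<in> borel_measurable (borel \<Otimes>\<^sub>M borel)" unfolding F_def by measurable
  have "integrable (lborel \<Otimes>\<^sub>M lborel) F"
  proof (rule lborel_pair.Fubini_integrable)
    show "AE x in lborel. integrable lborel (\<lambda>y. F (x, y))"
      using inv_sqrt_kernel_integrable by (simp add: F_def)
    show "integrable lborel (\<lambda>x. LINT y|lborel. norm (F (x, y)))"
      using inv_sqrt_kernel_integrable by (simp add: F_def abs_mult nonneg)
  qed simp
  then have F: "integrable lborel F" by (simp add: lborel_prod)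
  \<comment> \<open>The excluded axes are null sets.\<close>
  have "AE z in lebesgue. fst z \<noteq> 0 \<and> snd (z :: plane) \<noteq> 0"
  proof -
    have "negligible {z :: plane. (1, 0) \<bullet> z = 0}" "negligible {z :: plane. (0, 1) \<bullet> z = 0}"
      by (rule negligible_hyperplane, simp add: zero_prod_def)+
    then have "AE z in lebesgue. z \<notin> {z :: plane. (1, 0) \<bullet> z = 0}" "AE z in lebesgue. z \<notin> {z :: plane. (0, 1) \<bullet> z = 0}"
      unfolding negligible_iff_null_sets by (blast intro: AE_not_in)+
    then show ?thesis by eventually_elim (auto simp: inner_prod_def)
  qed
  then have ae: "AE z in lborel. fst z \<noteq> 0 \<and> snd (z :: plane) \<noteq> 0"
    by (simp add: AE_completion_iff)
  show ?thesis
  proof (rule Bochner_Integration.integrable_bound[OF F])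
    show "AE z in lborel. norm ((log_kernel z)\<^sup>2) \<le> norm (F z)"
      using ae by eventually_elim (use log_kernel_sq_le in \<open>auto simp: F_def nonneg\<close>)
  qed simp
qed

lemma sigma_finite_lebesgue: "sigma_finite_measure (lebesgue :: 'a::euclidean_space measure)"
proof
  obtain A :: "'a set set" where "countable A" "A \<subseteq> sets lborel" "\<Union> A = space lborel" "\<forall>a\<in>A. emeasure lborel a \<noteq> \<infinity>"
    using lborel.sigma_finite_countable by blast
  then show "\<exists>A :: 'a set set. countable A \<and> A \<subseteq> sets lebesgue \<and> \<Union> A = space lebesgue \<and> (\<forall>a\<in>A. emeasure lebesgue a \<noteq> \<infinity>)"
    by (intro exI[of _ A]) (auto simp: emeasure_completion)
qed

section \<open>Stream functions of square integrable vorticities with finite mass and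
  impulse\<close>

context green_domain
begin

abbreviation M :: "plane measure" where "M \<equiv> lebesgue_on \<Omega>"

lemma domain_sets: "\<Omega> \<in> sets lebesgue" "\<Omega> \<in> sets borel"
  using open_domain by auto

sublocale M: sigma_finite_measure M
  by (rule sigma_finite_measure_restrict_space[OF sigma_finite_lebesgue domain_sets(1)])

sublocale MM: pair_sigma_finite M M ..

lemma borel_measurable_M: "f \<in> borel_measurable borel \<Longrightarrow> f \<in> borel_measurable M"
  by (intro measurable_restrict_space1 measurable_completion) simp

lemma ident_measurable_M: "(\<lambda>x. x) \<in> M \<rightarrow>\<^sub>M borel"
  using id_borel_measurable_lebesgue_on by (simp add: id_def)

lemma snd_measurable_M: "(snd :: plane \<Rightarrow> real) \<in> borel_measurable M"
  by (rule borel_measurable_M) (simp add: borel_measurable_continuous_onI continuous_on_snd)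

lemma AE_neq: "AE y in M. y \<noteq> x"
proof -
  have "AE y in lebesgue. y \<notin> {x}" by (rule AE_not_in) (simp add: negligible_iff_null_sets[symmetric])
  then show ?thesis by (auto simp: AE_restrict_space_iff domain_sets elim: eventually_mono)
qed

text \<open>
  The values of \<open>G\<close> on the diagonal are unspecified, so \<open>G\<close> itself need not be jointly measurable.
\<close>

definition G0 :: "plane \<Rightarrow> plane \<Rightarrow> real" where
  "G0 x y = (if x \<in> \<Omega> \<and> y \<in> \<Omega> \<and> x \<noteq> y then G x y else 0)"

lemma G0_eq: "x \<in> \<Omega> \<Longrightarrow> y \<in> \<Omega> \<Longrightarrow> x \<noteq> y \<Longrightarrow> G x y = G0 x y"
  by (simp add: G0_def)

lemma G0_symmetric: "G0 x y = G0 y x"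
  using green_symmetric by (auto simp: G0_def)

lemma G0_nonneg: "0 \<le> G0 x y"
  using green_nonneg by (simp add: G0_def)

lemma G0_le: "x \<in> \<Omega> \<Longrightarrow> y \<in> \<Omega> \<Longrightarrow> G0 x y \<le> snd x + snd y + log_kernel (x - y)"
  using green_le[of x y] half_plane_green_le_log_kernel[of x y] snd_pos[of x] snd_pos[of y] log_kernel_nonneg[of "x - y"]
  by (cases "x = y") (auto simp: G0_def)

text \<open>Off the diagonal the decomposition of \<open>G\<close> is continuous on an open set, by
  joint continuity of the regular part; elsewhere \<open>G0\<close> is zero.\<close>

lemma G0_borel: "(\<lambda>p. G0 (fst p) (snd p)) \<in> borel_measurable borel"
proof -
  define A where "A = \<Omega> \<times> \<Omega> - {p. fst p = snd p}"
  have "closed {p :: plane \<times> plane. fst p = snd p}"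
    by (intro closed_Collect_eq continuous_intros)
  then have "open A" unfolding A_def by (intro open_Diff open_Times open_domain)
  have "continuous_on A (\<lambda>p. - ln (norm (fst p - snd p)) / (2 * pi) + regular_part (snd p) (fst p))"
    by (intro continuous_intros continuous_on_subset[OF regular_part_jointly_continuous]) (auto simp: A_def)
  then have "(\<lambda>p. indicator A p *\<^sub>R (- ln (norm (fst p - snd p)) / (2 * pi) + regular_part (snd p) (fst p))) \<in> borel_measurable borel"
    using \<open>open A\<close> by (intro borel_measurable_continuous_on_indicator) auto
  moreover have "G0 (fst p) (snd p) = indicator A p *\<^sub>R (- ln (norm (fst p - snd p)) / (2 * pi) + regular_part (snd p) (fst p))" for p
    using green_eq_regular_part[of "snd p" "fst p"] by (cases p) (auto simp: G0_def A_def indicator_def)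
  ultimately show ?thesis by simp
qed

lemma G0_measurable: "(\<lambda>p. G0 (fst p) (snd p)) \<in> borel_measurable (M \<Otimes>\<^sub>M M)"
proof -
  have "(\<lambda>p. (fst p, snd p)) \<in> M \<Otimes>\<^sub>M M \<rightarrow>\<^sub>M borel \<Otimes>\<^sub>M borel"
    by (intro measurable_Pair measurable_compose[OF measurable_fst ident_measurable_M]
        measurable_compose[OF measurable_snd ident_measurable_M])
  then have "(\<lambda>p. p) \<in> M \<Otimes>\<^sub>M M \<rightarrow>\<^sub>M (borel :: (plane \<times> plane) measure)"
    by (simp add: borel_prod)
  from measurable_compose[OF this G0_borel] show ?thesis .
qed

lemma G0_section_measurable: "x \<in> \<Omega> \<Longrightarrow> G0 x \<in> borel_measurable M"
  using measurable_compose[OF measurable_Pair1' G0_measurable, of x] by simp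

text \<open>\<open>stream\<close> integrates \<open>G\<close> itself; its section differs from that
  of \<open>G0\<close> at a single point of \<open>\<Omega>\<close>, whatever the diagonal value
  is.\<close>

lemma green_section_measurable: "x \<in> \<Omega> \<Longrightarrow> G x \<in> borel_measurable M"
proof -
  assume x: "x \<in> \<Omega>"
  have "{x} \<in> sets M" using x by (simp add: sets_restrict_space_iff domain_sets)
  moreover have "{y \<in> space M. y = x} = {x}" using x by auto
  ultimately have "(\<lambda>y. if y = x then G x x else G0 x y) \<in> borel_measurable M"
    using G0_section_measurable[OF x] by (intro measurable_If) auto
  then show ?thesis
    by (rule measurable_cong[THEN iffD1, rotated]) (use G0_eq x in auto)
qed

text \<open>The linear space underlying \<open>admissible\<close>: the integrability conditions
  remain, while sign and constraints are dropped so that perturbations are included.\<close>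

definition tame :: "(plane \<Rightarrow> real) \<Rightarrow> bool" where
  "tame f \<longleftrightarrow> f \<in> borel_measurable M \<and> integrable M f \<and> integrable M (\<lambda>x. (f x)\<^sup>2) \<and> integrable M (\<lambda>x. snd x * f x)"

lemma tame_product_integrable:
  assumes "tame f" "tame g"
  shows "integrable M (\<lambda>x. f x * g x)"
proof (rule Bochner_Integration.integrable_bound)
  show "integrable M (\<lambda>x. (f x)\<^sup>2 + (g x)\<^sup>2)" using assms by (auto simp: tame_def)
  show "(\<lambda>x. f x * g x) \<in> borel_measurable M" using assms by (auto simp: tame_def)
  have "\<bar>a * b\<bar> \<le> \<bar>a\<^sup>2 + b\<^sup>2\<bar>" for a b :: real
  proof -
    have "2 * \<bar>a * b\<bar> \<le> a\<^sup>2 + b\<^sup>2"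
      using zero_le_power2[of "\<bar>a\<bar> - \<bar>b\<bar>"] by (simp add: power2_diff abs_mult)
    then show ?thesis by linarith
  qed
  then show "AE x in M. norm (f x * g x) \<le> norm ((f x)\<^sup>2 + (g x)\<^sup>2)" by simp
qed

lemma tame_add: "tame f \<Longrightarrow> tame g \<Longrightarrow> tame (\<lambda>x. f x + g x)"
proof -
  assume fg: "tame f" "tame g"
  have "(\<lambda>x. (f x + g x)\<^sup>2) = (\<lambda>x. (f x)\<^sup>2 + (g x)\<^sup>2 + 2 * (f x * g x))"
    by (simp add: power2_sum algebra_simps)
  then have "integrable M (\<lambda>x. (f x + g x)\<^sup>2)"
    using fg tame_product_integrable[OF fg] by (simp add: tame_def)
  then show "tame (\<lambda>x. f x + g x)"
    using fg by (auto simp: tame_def distrib_left intro!: borel_measurable_add)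
qed

lemma tame_cmult: "tame f \<Longrightarrow> tame (\<lambda>x. c * f x)"
  unfolding tame_def power_mult_distrib mult.left_commute[of _ c] by auto

lemma tame_abs: "tame f \<Longrightarrow> tame (\<lambda>x. \<bar>f x\<bar>)"
proof -
  assume f: "tame f"
  have "integrable M (\<lambda>x. \<bar>snd x * f x\<bar>)" using f by (auto simp: tame_def)
  then have "integrable M (\<lambda>x. snd x * \<bar>f x\<bar>)"
    by (rule Bochner_Integration.integrable_cong[THEN iffD1, rotated -1]) (use snd_pos in \<open>auto simp: abs_mult less_imp_le\<close>)
  then show ?thesis using f by (auto simp: tame_def)
qed

definition kernel_mass :: real where
  "kernel_mass = (LINT z|lborel. (log_kernel z)\<^sup>2)"

text \<open>Translation invariance of Lebesgue measure makes the bound independent of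
  \<open>x\<close>.\<close>

lemma
  shows kernel_integrable: "integrable M (\<lambda>y. (log_kernel (x - y))\<^sup>2)"
    and kernel_integral_le: "(LINT y|M. (log_kernel (x - y))\<^sup>2) \<le> kernel_mass"
proof -
  have i: "integrable lborel (\<lambda>y. (log_kernel (- x + y))\<^sup>2)"
    using log_kernel_sq_integrable integrable_distr_eq[of "(+) (- x)" lborel borel "\<lambda>z. (log_kernel z)\<^sup>2"]
    by (simp add: lborel_distr_plus)
  have v: "(LINT y|lborel. (log_kernel (- x + y))\<^sup>2) = kernel_mass"
    using integral_distr[of "(+) (- x)" lborel borel "\<lambda>z. (log_kernel z)\<^sup>2"]
    by (simp add: lborel_distr_plus kernel_mass_def)
  have eq: "log_kernel (- x + y) = log_kernel (x - y)" for y
    using log_kernel_minus[of x y] by simp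
  have m: "(\<lambda>y. (log_kernel (x - y))\<^sup>2) \<in> borel_measurable borel" by measurable
  have i': "integrable lebesgue (\<lambda>y. (log_kernel (x - y))\<^sup>2)"
    using i unfolding eq by (simp add: integrable_completion)
  then have i'': "integrable lebesgue (\<lambda>y. indicator \<Omega> y *\<^sub>R (log_kernel (x - y))\<^sup>2)"
    using domain_sets by (intro integrable_mult_indicator)
  then show "integrable M (\<lambda>y. (log_kernel (x - y))\<^sup>2)"
    by (simp add: integrable_restrict_space domain_sets)
  have "(LINT y|M. (log_kernel (x - y))\<^sup>2) = (LINT y|lebesgue. indicator \<Omega> y *\<^sub>R (log_kernel (x - y))\<^sup>2)"
    by (simp add: integral_restrict_space domain_sets)
  also have "\<dots> \<le> (LINT y|lebesgue. (log_kernel (x - y))\<^sup>2)"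
    by (intro integral_mono i' i'') (auto simp: indicator_def)
  also have "\<dots> = kernel_mass"
    using v unfolding eq by (simp add: integral_completion)
  finally show "(LINT y|M. (log_kernel (x - y))\<^sup>2) \<le> kernel_mass" .
qed

definition stream_bound_const :: "(plane \<Rightarrow> real) \<Rightarrow> real" where
  "stream_bound_const f = (LINT y|M. \<bar>f y\<bar>) + (LINT y|M. snd y * \<bar>f y\<bar>) + kernel_mass + (LINT y|M. (f y)\<^sup>2)"

text \<open>The heights in \<open>G0_le\<close> are absorbed by mass and impulse, and the logarithm
  by \<open>k * a \<le> k\<^sup>2 + a\<^sup>2\<close>. The resulting growth is linear in
  \<open>snd x\<close>, so that a stream function can be integrated against another tame function.
  The diagonal is met only in a null set.\<close>

lemma
  assumes f: "tame f" and x: "x \<in> \<Omega>"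
  shows green_mult_integrable: "integrable M (\<lambda>y. G x y * f y)"
    and stream_bound: "\<bar>stream G \<Omega> f x\<bar> \<le> (1 + snd x) * stream_bound_const f"
    and stream_eq_G0: "stream G \<Omega> f x = (LINT y|M. G0 x y * f y)"
    and G0_mult_integrable: "integrable M (\<lambda>y. G0 x y * f y)"
proof -
  let ?b = "\<lambda>y. snd x * \<bar>f y\<bar> + snd y * \<bar>f y\<bar> + (log_kernel (x - y))\<^sup>2 + (f y)\<^sup>2"
  have fm: "f \<in> borel_measurable M" using f by (simp add: tame_def)
  have af: "integrable M (\<lambda>y. \<bar>f y\<bar>)" "integrable M (\<lambda>y. snd y * \<bar>f y\<bar>)" "integrable M (\<lambda>y. (f y)\<^sup>2)"
    using f tame_abs[OF f] by (auto simp: tame_def)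
  have b: "integrable M ?b" using af kernel_integrable by auto
  have G0_bound: "\<bar>G0 x y * f y\<bar> \<le> ?b y" if "y \<in> \<Omega>" for y
  proof -
    have "\<bar>G0 x y * f y\<bar> = G0 x y * \<bar>f y\<bar>" by (simp add: abs_mult G0_nonneg)
    also have "\<dots> \<le> (snd x + snd y + log_kernel (x - y)) * \<bar>f y\<bar>"
      using G0_le x that by (intro mult_right_mono) auto
    also have "\<dots> = snd x * \<bar>f y\<bar> + snd y * \<bar>f y\<bar> + log_kernel (x - y) * \<bar>f y\<bar>"
      by (simp add: algebra_simps)
    finally have "\<bar>G0 x y * f y\<bar> \<le> snd x * \<bar>f y\<bar> + snd y * \<bar>f y\<bar> + log_kernel (x - y) * \<bar>f y\<bar>" .
    moreover have "log_kernel (x - y) * \<bar>f y\<bar> \<le> (log_kernel (x - y))\<^sup>2 + (f y)\<^sup>2"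
    proof -
      have "k * a \<le> k\<^sup>2 + a\<^sup>2" if "k \<ge> 0" "a \<ge> 0" for k a :: real
        using zero_le_power2[of "k - a"] mult_nonneg_nonneg[OF that] by (simp add: power2_diff)
      from this[OF log_kernel_nonneg, of "\<bar>f y\<bar>" "x - y"] show ?thesis by simp
    qed
    ultimately show ?thesis by linarith
  qed
  have m0: "(\<lambda>y. G0 x y * f y) \<in> borel_measurable M"
    using G0_section_measurable[OF x] fm by simp
  have m: "(\<lambda>y. G x y * f y) \<in> borel_measurable M"
    using green_section_measurable[OF x] fm by simp
  have ae: "AE y in M. G0 x y * f y = G x y * f y"
    using AE_neq[of x] AE_space by eventually_elim (use G0_eq x in auto)
  show i0: "integrable M (\<lambda>y. G0 x y * f y)"
  proof (rule Bochner_Integration.integrable_bound[OF b m0])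
    have "norm (G0 x y * f y) \<le> norm (?b y)" if "y \<in> \<Omega>" for y
      using G0_bound[OF that] by (simp only: real_norm_def)
    then show "AE y in M. norm (G0 x y * f y) \<le> norm (?b y)" by (intro AE_I2) simp
  qed
  then show "integrable M (\<lambda>y. G x y * f y)"
    by (rule integrable_cong_AE_imp[OF _ m]) (use ae in auto)
  show eq: "stream G \<Omega> f x = (LINT y|M. G0 x y * f y)"
    unfolding stream_def by (rule integral_cong_AE[OF m m0]) (use ae in auto)
  have "\<bar>stream G \<Omega> f x\<bar> \<le> (LINT y|M. \<bar>G0 x y * f y\<bar>)"
    unfolding eq by (rule integral_abs_bound)
  also have "\<dots> \<le> (LINT y|M. ?b y)"
    using G0_bound by (intro integral_mono integrable_abs i0 b) auto
  also have "\<dots> = snd x * (LINT y|M. \<bar>f y\<bar>) + (LINT y|M. snd y * \<bar>f y\<bar>) + (LINT y|M. (log_kernel (x - y))\<^sup>2) + (LINT y|M. (f y)\<^sup>2)"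
    using af kernel_integrable by simp
  also have "\<dots> \<le> snd x * (LINT y|M. \<bar>f y\<bar>) + (LINT y|M. snd y * \<bar>f y\<bar>) + kernel_mass + (LINT y|M. (f y)\<^sup>2)"
    using kernel_integral_le by simp
  also have "\<dots> \<le> (1 + snd x) * stream_bound_const f"
  proof -
    have "0 \<le> (LINT y|M. \<bar>f y\<bar>)" "0 \<le> (LINT y|M. (f y)\<^sup>2)" by simp_all
    moreover have "0 \<le> (LINT y|M. snd y * \<bar>f y\<bar>)"
      by (rule Bochner_Integration.integral_nonneg) (use snd_pos in \<open>auto simp: less_imp_le\<close>)
    moreover have "0 \<le> kernel_mass" unfolding kernel_mass_def by simp
    ultimately have "(LINT y|M. \<bar>f y\<bar>) \<le> stream_bound_const f" "0 \<le> (LINT y|M. \<bar>f y\<bar>)" "0 \<le> stream_bound_const f"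
      by (simp_all add: stream_bound_const_def)
    then have "snd x * (LINT y|M. \<bar>f y\<bar>) \<le> snd x * stream_bound_const f"
      using snd_pos[OF x] by (intro mult_left_mono) auto
    moreover have "(1 + snd x) * stream_bound_const f = stream_bound_const f + snd x * stream_bound_const f"
      by (simp add: algebra_simps)
    ultimately show ?thesis using \<open>0 \<le> (LINT y|M. \<bar>f y\<bar>)\<close> stream_bound_const_def[of f] by linarith
  qed
  finally show "\<bar>stream G \<Omega> f x\<bar> \<le> (1 + snd x) * stream_bound_const f" .
qed

lemma G0_mult_measurable:
  "f \<in> borel_measurable M \<Longrightarrow> (\<lambda>p. G0 (fst p) (snd p) * f (snd p)) \<in> borel_measurable (M \<Otimes>\<^sub>M M)"
  by (intro borel_measurable_times G0_measurable measurable_compose[OF measurable_snd])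

lemma stream_measurable:
  assumes "tame f"
  shows "stream G \<Omega> f \<in> borel_measurable M"
proof -
  have "(\<lambda>x. LINT y|M. G0 x y * f y) \<in> borel_measurable M"
    by (rule M.borel_measurable_lebesgue_integral)
       (use G0_mult_measurable[of f] assms in \<open>simp add: tame_def case_prod_beta'\<close>)
  then show ?thesis
    by (rule measurable_cong[THEN iffD1, rotated]) (simp add: stream_eq_G0[OF assms])
qed

lemma tame_stream_integrable:
  assumes f: "tame f" and g: "tame g"
  shows "integrable M (\<lambda>x. f x * stream G \<Omega> g x)"
proof (rule Bochner_Integration.integrable_bound)
  have "integrable M (\<lambda>x. stream_bound_const g * (\<bar>f x\<bar> + snd x * \<bar>f x\<bar>))"
    using f tame_abs[OF f] by (auto simp: tame_def)
  then show "integrable M (\<lambda>x. \<bar>f x\<bar> * ((1 + snd x) * stream_bound_const g))"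
    by (simp add: algebra_simps)
  show "(\<lambda>x. f x * stream G \<Omega> g x) \<in> borel_measurable M"
    using f stream_measurable[OF g] by (intro borel_measurable_times) (auto simp: tame_def)
  have "norm (f x * stream G \<Omega> g x) \<le> norm (\<bar>f x\<bar> * ((1 + snd x) * stream_bound_const g))" if "x \<in> \<Omega>" for x
  proof -
    have "norm (f x * stream G \<Omega> g x) \<le> \<bar>f x\<bar> * ((1 + snd x) * stream_bound_const g)"
      using stream_bound[OF g that] by (simp add: abs_mult mult_left_mono)
    then show ?thesis by (metis abs_ge_self order_trans real_norm_def)
  qed
  then show "AE x in M. norm (f x * stream G \<Omega> g x) \<le> norm (\<bar>f x\<bar> * ((1 + snd x) * stream_bound_const g))"
    by (intro AE_I2) simp
qed

text \<open>Fubini with the symmetric kernel \<open>G0\<close>. As \<open>G0\<close> is nonnegative,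
  absolute integrability is the finiteness already known for the pair of absolute values.\<close>

lemma stream_symmetric:
  assumes f: "tame f" and g: "tame g"
  shows "(LINT x|M. f x * stream G \<Omega> g x) = (LINT x|M. g x * stream G \<Omega> f x)"
proof -
  let ?F = "\<lambda>x y. f x * (G0 x y * g y)"
  have int: "integrable (M \<Otimes>\<^sub>M M) (case_prod ?F)"
  proof (rule MM.Fubini_integrable)
    have "(\<lambda>p. f (fst p) * (G0 (fst p) (snd p) * g (snd p))) \<in> borel_measurable (M \<Otimes>\<^sub>M M)"
      using f g by (intro borel_measurable_times G0_measurable measurable_compose[OF measurable_snd] measurable_compose[OF measurable_fst])
        (auto simp: tame_def)
    then show "case_prod ?F \<in> borel_measurable (M \<Otimes>\<^sub>M M)" by (simp add: case_prod_beta')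
    show "AE x in M. integrable M (\<lambda>y. case (x, y) of (x, y) \<Rightarrow> ?F x y)"
      using G0_mult_integrable[OF g] by (intro AE_I2) auto
    have "integrable M (\<lambda>x. \<bar>f x\<bar> * stream G \<Omega> (\<lambda>y. \<bar>g y\<bar>) x)"
      by (intro tame_stream_integrable tame_abs f g)
    then show "integrable M (\<lambda>x. LINT y|M. norm (case (x, y) of (x, y) \<Rightarrow> ?F x y))"
      by (rule Bochner_Integration.integrable_cong[THEN iffD1, rotated -1])
         (auto simp: stream_eq_G0[OF tame_abs[OF g]] abs_mult G0_nonneg)
  qed
  have "(LINT x|M. f x * stream G \<Omega> g x) = (LINT x|M. LINT y|M. ?F x y)"
    by (rule Bochner_Integration.integral_cong) (auto simp: stream_eq_G0[OF g])
  also have "\<dots> = (LINT y|M. LINT x|M. ?F x y)"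
    by (rule MM.Fubini_integral[OF int, symmetric])
  also have "\<dots> = (LINT y|M. g y * stream G \<Omega> f y)"
  proof (rule Bochner_Integration.integral_cong)
    fix y assume "y \<in> space M"
    have "(LINT x|M. ?F x y) = (LINT x|M. g y * (G0 y x * f x))"
      by (rule Bochner_Integration.integral_cong) (simp_all add: G0_symmetric[of y] ac_simps)
    then show "(LINT x|M. ?F x y) = g y * stream G \<Omega> f y"
      using \<open>y \<in> space M\<close> by (simp add: stream_eq_G0[OF f])
  qed simp
  finally show ?thesis .
qed

lemma stream_add_cmult:
  assumes "tame f" "tame g" "x \<in> \<Omega>"
  shows "stream G \<Omega> (\<lambda>x. f x + t * g x) x = stream G \<Omega> f x + t * stream G \<Omega> g x"
proof -
  have "stream G \<Omega> (\<lambda>x. f x + t * g x) x = (LINT y|M. G x y * f y + t * (G x y * g y))"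
    unfolding stream_def by (intro Bochner_Integration.integral_cong) (auto simp: algebra_simps)
  also have "\<dots> = stream G \<Omega> f x + t * stream G \<Omega> g x"
    unfolding stream_def using green_mult_integrable assms by simp
  finally show ?thesis .
qed

lemma energy_eq: "energy G \<Omega> f = 1 / 2 * (LINT x|M. f x * stream G \<Omega> f x)"
proof -
  have "(LINT y|M. G x y * f x * f y) = f x * stream G \<Omega> f x" for x
    unfolding stream_def integral_mult_right_zero[symmetric] by (simp add: ac_simps)
  then show ?thesis by (simp add: energy_def)
qed

text \<open>The functional is quadratic, so the expansion is exact; symmetry of the energy form
  merges the two cross terms. With \<open>lam = 0\<close> every quotient by \<open>lam\<close> is 0
  and the identity persists.\<close>

lemma energy2_variation:
  assumes f: "tame f" and g: "tame g"
  shows "energy2 G \<Omega> lam (\<lambda>x. f x + t * g x) =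
    energy2 G \<Omega> lam f + t * (LINT x|M. g x * (stream G \<Omega> f x - f x / lam)) + t\<^sup>2 * energy2 G \<Omega> lam g"
proof -
  let ?P = "stream G \<Omega>"
  have "(LINT x|M. (f x + t * g x) * ?P (\<lambda>x. f x + t * g x) x)
      = (LINT x|M. f x * ?P f x + t * (f x * ?P g x) + t * (g x * ?P f x) + t\<^sup>2 * (g x * ?P g x))"
    by (rule Bochner_Integration.integral_cong)
       (auto simp: stream_add_cmult[OF f g] algebra_simps power2_eq_square)
  also have "\<dots> = (LINT x|M. f x * ?P f x) + t * (LINT x|M. f x * ?P g x) + t * (LINT x|M. g x * ?P f x) + t\<^sup>2 * (LINT x|M. g x * ?P g x)"
    using tame_stream_integrable f g by simp
  also have "(LINT x|M. f x * ?P g x) = (LINT x|M. g x * ?P f x)"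
    by (rule stream_symmetric[OF f g])
  finally have 1: "energy G \<Omega> (\<lambda>x. f x + t * g x) = energy G \<Omega> f + t * (LINT x|M. g x * ?P f x) + t\<^sup>2 * energy G \<Omega> g"
    unfolding energy_eq by (simp add: algebra_simps)
  have sq: "integrable M (\<lambda>x. (f x)\<^sup>2)" "integrable M (\<lambda>x. (g x)\<^sup>2)" "integrable M (\<lambda>x. g x * f x)"
    using f g tame_product_integrable by (auto simp: tame_def)
  have "(LINT x|M. (f x + t * g x)\<^sup>2) = (LINT x|M. (f x)\<^sup>2 + 2 * t * (g x * f x) + t\<^sup>2 * (g x)\<^sup>2)"
    by (rule Bochner_Integration.integral_cong) (auto simp: power2_sum algebra_simps power_mult_distrib)
  also have "\<dots> = (LINT x|M. (f x)\<^sup>2) + 2 * t * (LINT x|M. g x * f x) + t\<^sup>2 * (LINT x|M. (g x)\<^sup>2)"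
    using sq by simp
  finally have 2: "(LINT x|M. (f x + t * g x)\<^sup>2) = \<dots>" .
  have "(LINT x|M. g x * (?P f x - f x / lam)) = (LINT x|M. g x * ?P f x - (1 / lam) * (g x * f x))"
    by (rule Bochner_Integration.integral_cong) (auto simp: algebra_simps)
  also have "\<dots> = (LINT x|M. g x * ?P f x) - (1 / lam) * (LINT x|M. g x * f x)"
    using sq tame_stream_integrable[OF g f] by simp
  finally have 3: "(LINT x|M. g x * (?P f x - f x / lam)) = \<dots>" .
  show ?thesis
    unfolding energy2_def 1 2 3 by (cases "lam = 0") (simp_all add: field_simps)
qed

end

subsection \<open>Lagrange multipliers\<close>

context green_domain
begin

lemma bounded_support_integrable:
  fixes f :: "plane \<Rightarrow> real"
  assumes "f \<in> borel_measurable M" and "\<And>x. x \<in> \<Omega> \<Longrightarrow> \<bar>f x\<bar> \<le> c" and "\<And>x. x \<in> \<Omega> \<Longrightarrow> R < norm x \<Longrightarrow> f x = 0"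
  shows "integrable M f"
proof (rule Bochner_Integration.integrable_bound[OF _ assms(1)])
  have "integrable lborel (indicator (cball (0::plane) R) :: plane \<Rightarrow> real)"
    by (intro integrable_real_indicator emeasure_bounded_finite) auto
  then have "integrable lebesgue (indicator (cball (0::plane) R) :: plane \<Rightarrow> real)"
    by (simp add: integrable_completion)
  then have "integrable lebesgue (\<lambda>x. indicator \<Omega> x *\<^sub>R (indicator (cball (0::plane) R) x :: real))"
    using domain_sets by (intro integrable_mult_indicator)
  then have "integrable M (indicator (cball (0::plane) R) :: plane \<Rightarrow> real)"
    by (simp add: integrable_restrict_space domain_sets)
  then show "integrable M (\<lambda>x. c * indicator (cball (0::plane) R) x :: real)"
    by simp
  have "norm (f x) \<le> norm (c * indicator (cball (0::plane) R) x :: real)" if "x \<in> \<Omega>" for x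
    using assms(2,3)[OF that] by (cases "norm x \<le> R") (auto simp: indicator_def)
  then show "AE x in M. norm (f x) \<le> norm (c * indicator (cball (0::plane) R) x :: real)"
    by (intro AE_I2) simp
qed

lemma bounded_support_tame:
  assumes m: "f \<in> borel_measurable M" and c: "\<And>x. x \<in> \<Omega> \<Longrightarrow> \<bar>f x\<bar> \<le> c" and R: "\<And>x. x \<in> \<Omega> \<Longrightarrow> R < norm x \<Longrightarrow> f x = 0"
  shows "tame f"
  unfolding tame_def
proof (intro conjI m)
  show "integrable M f" by (rule bounded_support_integrable[OF m c R])
  show "integrable M (\<lambda>x. (f x)\<^sup>2)"
  proof (rule bounded_support_integrable)
    show "\<bar>(f x)\<^sup>2\<bar> \<le> c\<^sup>2" if "x \<in> \<Omega>" for x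
      using power_mono[OF c[OF that] abs_ge_zero, of 2] by simp
  qed (use m R in auto)
  show "integrable M (\<lambda>x. snd x * f x)"
  proof (rule bounded_support_integrable)
    show "\<bar>snd x * f x\<bar> \<le> \<bar>R\<bar> * c" if "x \<in> \<Omega>" for x
    proof (cases "norm x \<le> R")
      case True
      have "\<bar>snd x\<bar> \<le> norm x" by (cases x) (simp add: norm_Pair real_le_rsqrt)
      then show ?thesis using True c[OF that] unfolding abs_mult by (intro mult_mono) auto
    next
      case False
      then show ?thesis using R[OF that] c[OF that] by simp
    qed
    show "(\<lambda>x. snd x * f x) \<in> borel_measurable M"
      using m snd_measurable_M by (intro borel_measurable_times)
  qed (use R in auto)
qed

lemma admissible_tame: "\<omega> \<in> admissible \<Omega> \<mu> \<Longrightarrow> tame \<omega>"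
  by (simp add: admissible_def tame_def)

text \<open>
  The hypothesis on \<open>\<epsilon>\<close> makes \<open>\<omega> + t \<phi>\<close> nonnegative for small \<open>t\<close>.
\<close>

lemma minimizer_variation_le:
  assumes min: "\<omega> \<in> minimizers G \<Omega> \<mu> lam" and \<phi>: "tame \<phi>"
    and c: "\<And>x. x \<in> \<Omega> \<Longrightarrow> \<bar>\<phi> x\<bar> \<le> c"
    and \<epsilon>: "\<epsilon> > 0" "\<And>x. x \<in> \<Omega> \<Longrightarrow> 0 \<le> \<phi> x \<or> \<epsilon> \<le> \<omega> x"
    and mass: "(LINT x|M. \<phi> x) = 0" and impulse: "(LINT x|M. snd x * \<phi> x) = 0"
  shows "(LINT x|M. \<phi> x * (stream G \<Omega> \<omega> x - \<omega> x / lam)) \<le> 0"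
proof (rule ccontr)
  have adm: "\<omega> \<in> admissible \<Omega> \<mu>" using min by (simp add: minimizers_def)
  note \<omega> = admissible_tame[OF adm]
  define a where "a = (LINT x|M. \<phi> x * (stream G \<Omega> \<omega> x - \<omega> x / lam))"
  define b where "b = energy2 G \<Omega> lam \<phi>"
  assume "\<not> ?thesis"
  then have "a > 0" by (simp add: a_def)
  \<comment> \<open>The first entry keeps \<open>t * \<bar>\<phi> x\<bar>\<close> below
    \<open>\<epsilon>\<close>; the second keeps the quadratic term below half of the linear
    one.\<close>
  define t where "t = min (\<epsilon> / (\<bar>c\<bar> + 1)) (a / (2 * (\<bar>b\<bar> + 1)))"
  have "t > 0" using \<epsilon> \<open>a > 0\<close> by (simp add: t_def add_nonneg_pos)
  have "t \<le> \<epsilon> / (\<bar>c\<bar> + 1)" by (simp add: t_def)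
  then have tc: "t * (\<bar>c\<bar> + 1) \<le> \<epsilon>" by (simp add: pos_le_divide_eq add_nonneg_pos)
  have "t \<le> a / (2 * (\<bar>b\<bar> + 1))" by (simp add: t_def)
  then have tb: "t * (2 * (\<bar>b\<bar> + 1)) \<le> a" by (simp add: pos_le_divide_eq add_nonneg_pos)
  let ?\<xi> = "\<lambda>x. \<omega> x + t * \<phi> x"
  have "tame ?\<xi>" by (intro tame_add tame_cmult \<omega> \<phi>)
  moreover have "AE x in M. 0 \<le> ?\<xi> x"
  proof -
    have "AE x in M. 0 \<le> \<omega> x" using adm by (simp add: admissible_def)
    then show ?thesis using AE_space
    proof eventually_elim
      fix x assume x: "0 \<le> \<omega> x" "x \<in> space M"
      show "0 \<le> ?\<xi> x"
      proof (cases "0 \<le> \<phi> x")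
        case False
        then have "\<epsilon> \<le> \<omega> x" using \<epsilon>(2)[of x] x by auto
        have "\<bar>\<phi> x\<bar> \<le> \<bar>c\<bar> + 1" using c[of x] x by auto
        then have "t * \<bar>\<phi> x\<bar> \<le> \<epsilon>" using tc \<open>t > 0\<close> by (meson less_imp_le mult_left_mono order_trans)
        then show ?thesis using \<open>\<epsilon> \<le> \<omega> x\<close> False by simp
      qed (use x \<open>t > 0\<close> in simp)
    qed
  qed
  moreover have "(LINT x|M. snd x * ?\<xi> x) = \<mu>"
  proof -
    have "(LINT x|M. snd x * ?\<xi> x) = (LINT x|M. snd x * \<omega> x + t * (snd x * \<phi> x))"
      by (simp add: algebra_simps)
    also have "\<dots> = \<mu>" using \<omega> \<phi> impulse adm by (simp add: tame_def admissible_def)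
    finally show ?thesis .
  qed
  moreover have "(LINT x|M. ?\<xi> x) \<le> 1"
    using \<omega> \<phi> mass adm by (simp add: tame_def admissible_def)
  ultimately have "?\<xi> \<in> admissible \<Omega> \<mu>" by (simp add: admissible_def tame_def)
  then have "min_value G \<Omega> \<mu> lam \<le> ereal (- energy2 G \<Omega> lam ?\<xi>)"
    unfolding min_value_def by (rule INF_lower)
  moreover have "min_value G \<Omega> \<mu> lam = ereal (- energy2 G \<Omega> lam \<omega>)"
    using min by (simp add: minimizers_def)
  ultimately have "energy2 G \<Omega> lam ?\<xi> \<le> energy2 G \<Omega> lam \<omega>" by simp
  then have "t * a + t\<^sup>2 * b \<le> 0"
    unfolding energy2_variation[OF \<omega> \<phi>] a_def b_def by simp
  then have "t * (a + t * b) \<le> 0" by (simp add: algebra_simps power2_eq_square)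
  then have "a + t * b \<le> 0" using \<open>t > 0\<close> by (simp add: mult_le_0_iff)
  moreover have "\<bar>t * b\<bar> \<le> t * (\<bar>b\<bar> + 1)" using \<open>t > 0\<close> by (simp add: abs_mult)
  ultimately show False using tb \<open>a > 0\<close> by (simp add: algebra_simps abs_le_iff)
qed

text \<open>Prevents \<open>snd\<close> from being constant on a set of positive measure. Both the
  positive variance in \<open>moment_dual_functions\<close> and the uniqueness in
  \<open>profile_unique\<close> rest on this.\<close>

lemma horizontal_line_null: "AE x in M. snd x \<noteq> c"
proof -
  have "negligible {z :: plane. (0, 1) \<bullet> z = c}"
    by (rule negligible_hyperplane) (simp add: zero_prod_def)
  then have "AE z in lebesgue. z \<notin> {z :: plane. (0, 1) \<bullet> z = c}"
    unfolding negligible_iff_null_sets by (rule AE_not_in)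
  then show ?thesis
    by (auto simp: AE_restrict_space_iff domain_sets inner_prod_def elim: eventually_mono)
qed

text \<open>Gram-Schmidt in the span of the indicator \<open>I\<close> of \<open>A\<close> and
  \<open>snd x * I x\<close>. The Gram determinant is nonzero because the integral \<open>v\<close>
  of \<open>(snd x - m)\<^sup>2\<close> over \<open>A\<close> is positive.\<close>

lemma moment_dual_functions:
  assumes A: "A \<in> sets M" "\<And>x. x \<in> A \<Longrightarrow> norm x \<le> R" and pos: "\<not> (AE x in M. x \<notin> A)"
  obtains \<eta>1 \<eta>2 c where
    "\<eta>1 \<in> borel_measurable M" "\<eta>2 \<in> borel_measurable M"
    "\<forall>x. x \<notin> A \<longrightarrow> \<eta>1 x = 0" "\<forall>x. x \<notin> A \<longrightarrow> \<eta>2 x = 0"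
    "\<forall>x. \<bar>\<eta>1 x\<bar> \<le> c" "\<forall>x. \<bar>\<eta>2 x\<bar> \<le> c"
    "(LINT x|M. \<eta>1 x) = 1" "(LINT x|M. snd x * \<eta>1 x) = 0"
    "(LINT x|M. \<eta>2 x) = 0" "(LINT x|M. snd x * \<eta>2 x) = 1"
proof -
  define I where "I = (indicator A :: plane \<Rightarrow> real)"
  have I[measurable]: "I \<in> borel_measurable M" unfolding I_def using A by simp
  note snd_measurable_M[measurable]
  have I0: "I x = 0" if "x \<notin> A" for x using that by (simp add: I_def)
  have I1: "I x = 1" if "x \<in> A" for x using that by (simp add: I_def)
  have sndR: "\<bar>snd x\<bar> \<le> R" if "x \<in> A" for x
  proof -
    have "\<bar>snd x\<bar> \<le> norm x" by (cases x) (simp add: norm_Pair real_le_rsqrt)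
    then show ?thesis using A(2)[OF that] by linarith
  qed
  have A\<Omega>: "A \<subseteq> \<Omega>" using sets.sets_into_space[OF A(1)] by simp
  have "A \<noteq> {}" using pos by auto
  then have "R \<ge> 0" using A(2) norm_ge_zero order_trans by blast
  have outside: "x \<notin> A" if "R < norm x" for x using A(2)[of x] that by auto
  have intk: "integrable M (\<lambda>x. (snd x) ^ k * I x)" for k
  proof (rule bounded_support_integrable)
    show "\<bar>(snd x) ^ k * I x\<bar> \<le> R ^ k" for x
      using sndR[of x] \<open>R \<ge> 0\<close> by (cases "x \<in> A") (auto simp: I0 I1 power_abs power_mono)
    show "(snd x) ^ k * I x = 0" if "R < norm x" for x
      using outside[OF that] by (simp add: I0)
  qed measurable
  define m0 m1 m2 where "m0 = (LINT x|M. I x)" and "m1 = (LINT x|M. snd x * I x)" and "m2 = (LINT x|M. (snd x)\<^sup>2 * I x)"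
  have int: "integrable M I" "integrable M (\<lambda>x. snd x * I x)" "integrable M (\<lambda>x. (snd x)\<^sup>2 * I x)"
    using intk[of 0] intk[of 1] intk[of 2] by simp_all
  have nonneg_pos: "0 < (LINT x|M. f x)"
    if "integrable M f" "\<And>x. 0 \<le> f x" "AE x in M. f x = 0 \<longrightarrow> x \<notin> A" for f :: "plane \<Rightarrow> real"
  proof -
    have "(LINT x|M. f x) \<noteq> 0"
    proof
      assume "(LINT x|M. f x) = 0"
      then have "AE x in M. f x = 0"
        using integral_nonneg_eq_0_iff_AE[OF that(1)] that(2) by simp
      with that(3) have "AE x in M. x \<notin> A" by eventually_elim simp
      then show False using pos by simp
    qed
    moreover have "0 \<le> (LINT x|M. f x)" using that(2) by simp
    ultimately show ?thesis by simp
  qed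
  have "m0 > 0" unfolding m0_def
    by (rule nonneg_pos[OF int(1)]) (auto simp: I_def)
  \<comment> \<open>The mean height of \<open>A\<close>; centring at it makes \<open>\<eta>2\<close>
    orthogonal to constants.\<close>
  define m where "m = m1 / m0"
  have vint: "integrable M (\<lambda>x. (snd x - m)\<^sup>2 * I x)"
    and v_eq: "(LINT x|M. (snd x - m)\<^sup>2 * I x) = m2 - m * m1"
  proof -
    have eq: "(\<lambda>x. (snd x - m)\<^sup>2 * I x) = (\<lambda>x. (snd x)\<^sup>2 * I x - 2 * m * (snd x * I x) + m\<^sup>2 * I x)"
      by (intro ext) (simp add: power2_diff algebra_simps)
    show "integrable M (\<lambda>x. (snd x - m)\<^sup>2 * I x)" unfolding eq using int by simp
    have "(LINT x|M. (snd x - m)\<^sup>2 * I x) = m2 - 2 * m * m1 + m\<^sup>2 * m0"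
      unfolding eq m0_def m1_def m2_def using int by simp
    also have "\<dots> = m2 - m * m1" using \<open>m0 > 0\<close> by (simp add: m_def power2_eq_square)
    finally show "(LINT x|M. (snd x - m)\<^sup>2 * I x) = m2 - m * m1" .
  qed
  define v where "v = m2 - m * m1"
  have "v > 0" unfolding v_def v_eq[symmetric]
  proof (rule nonneg_pos[OF vint])
    show "AE x in M. (snd x - m)\<^sup>2 * I x = 0 \<longrightarrow> x \<notin> A"
      using horizontal_line_null[of m] by eventually_elim (auto simp: I_def)
  qed (simp add: I_def)
  define \<eta>2 where "\<eta>2 x = (snd x * I x - m * I x) / v" for x
  define \<eta>1 where "\<eta>1 x = I x / m0 - m * \<eta>2 x" for x
  have i2: "integrable M \<eta>2" "integrable M (\<lambda>x. snd x * \<eta>2 x)"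
    and e2: "(LINT x|M. \<eta>2 x) = 0" "(LINT x|M. snd x * \<eta>2 x) = 1"
  proof -
    show "integrable M \<eta>2" unfolding \<eta>2_def using int by simp
    show "(LINT x|M. \<eta>2 x) = 0" unfolding \<eta>2_def using int \<open>m0 > 0\<close> by (simp add: m_def m0_def m1_def)
    have eq: "(\<lambda>x. snd x * \<eta>2 x) = (\<lambda>x. ((snd x)\<^sup>2 * I x - m * (snd x * I x)) / v)"
      by (intro ext) (simp add: \<eta>2_def power2_eq_square algebra_simps)
    show "integrable M (\<lambda>x. snd x * \<eta>2 x)" unfolding eq using int by simp
    have "(LINT x|M. snd x * \<eta>2 x) = v / v"
      unfolding eq using int by (simp add: v_def m1_def m2_def)
    then show "(LINT x|M. snd x * \<eta>2 x) = 1" using \<open>v > 0\<close> by simp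
  qed
  have e1: "(LINT x|M. \<eta>1 x) = 1"
    unfolding \<eta>1_def using int i2 e2 \<open>m0 > 0\<close> by (simp add: m0_def)
  have eq1: "(\<lambda>x. snd x * \<eta>1 x) = (\<lambda>x. (snd x * I x) / m0 - m * (snd x * \<eta>2 x))"
    by (intro ext) (simp add: \<eta>1_def algebra_simps)
  have e1': "(LINT x|M. snd x * \<eta>1 x) = 0"
    unfolding eq1 using int i2 e2 by (simp add: m_def m1_def)
  define c2 where "c2 = (R + \<bar>m\<bar>) / v"
  have b2: "\<bar>\<eta>2 x\<bar> \<le> c2" for x
  proof (cases "x \<in> A")
    case True
    have "\<bar>snd x - m\<bar> \<le> R + \<bar>m\<bar>" using sndR[OF True] by linarith
    then show ?thesis using \<open>v > 0\<close> by (simp add: \<eta>2_def c2_def I1[OF True] divide_right_mono)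
  qed (use \<open>R \<ge> 0\<close> \<open>v > 0\<close> in \<open>simp add: \<eta>2_def I0 c2_def\<close>)
  define c1 where "c1 = 1 / m0 + \<bar>m\<bar> * c2"
  have b1: "\<bar>\<eta>1 x\<bar> \<le> c1" for x
  proof -
    have "\<bar>\<eta>1 x\<bar> \<le> \<bar>I x / m0\<bar> + \<bar>m * \<eta>2 x\<bar>" unfolding \<eta>1_def by (rule abs_triangle_ineq4)
    also have "\<bar>I x / m0\<bar> \<le> 1 / m0" using \<open>m0 > 0\<close> by (cases "x \<in> A") (auto simp: I0 I1)
    also have "\<bar>m * \<eta>2 x\<bar> \<le> \<bar>m\<bar> * c2" unfolding abs_mult using b2 by (intro mult_left_mono) auto
    finally show ?thesis by (simp add: c1_def)
  qed
  show thesis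
  proof (rule that[of \<eta>1 \<eta>2 "max c1 c2"])
    show "\<eta>2 \<in> borel_measurable M" unfolding \<eta>2_def by measurable
    then show "\<eta>1 \<in> borel_measurable M" unfolding \<eta>1_def using I by simp
    show "\<forall>x. \<bar>\<eta>1 x\<bar> \<le> max c1 c2" "\<forall>x. \<bar>\<eta>2 x\<bar> \<le> max c1 c2"
      using b1 b2 by (auto simp: le_max_iff_disj)
    show "\<forall>x. x \<notin> A \<longrightarrow> \<eta>1 x = 0" "\<forall>x. x \<notin> A \<longrightarrow> \<eta>2 x = 0"
      using I0 by (simp_all add: \<eta>1_def \<eta>2_def)
  qed (rule e1 e1' e2)+
qed

lemma not_AE_nonpos:
  assumes "tame \<omega>" "(LINT x|M. snd x * \<omega> x) \<noteq> 0" "AE x in M. 0 \<le> \<omega> x"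
  shows "\<not> (AE x in M. \<omega> x \<le> 0)"
proof
  assume "AE x in M. \<omega> x \<le> 0"
  with assms(3) have "AE x in M. snd x * \<omega> x = 0" by eventually_elim simp
  moreover have "(\<lambda>x. snd x * \<omega> x) \<in> borel_measurable M" using assms(1) by (auto simp: tame_def)
  ultimately have "(LINT x|M. snd x * \<omega> x) = (LINT x|M. 0)"
    by (intro integral_cong_AE) auto
  then show False using assms(2) by simp
qed

text \<open>Each integrand is nonnegative, so a nonpositive integral makes it vanish almost
  everywhere, and countably many \<open>n\<close> are combined. \<open>P\<close> localizes to sets
  whose indicator, up to sign, is a permitted test function.\<close>

lemma AE_indicator_integral_le_zero:
  fixes s :: "plane \<Rightarrow> real"
  assumes s: "s \<in> borel_measurable M"
    and le: "\<And>n::nat. (LINT x|M. indicator {x \<in> \<Omega>. 0 < s x \<and> P n x} x * s x) \<le> 0"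
    and int: "\<And>n::nat. integrable M (\<lambda>x. indicator {x \<in> \<Omega>. 0 < s x \<and> P n x} x * s x)"
  shows "AE x in M. (\<exists>n. P n x) \<longrightarrow> s x \<le> 0"
proof -
  have "AE x in M. indicator {x \<in> \<Omega>. 0 < s x \<and> P n x} x * s x = 0" for n
  proof -
    have nonneg: "0 \<le> indicator {x \<in> \<Omega>. 0 < s x \<and> P n x} x * s x" for x
      by (cases "x \<in> {x \<in> \<Omega>. 0 < s x \<and> P n x}") auto
    then have "(LINT x|M. indicator {x \<in> \<Omega>. 0 < s x \<and> P n x} x * s x) = 0"
      using le[of n] by (intro antisym integral_nonneg_AE) auto
    then show ?thesis
      using integral_nonneg_eq_0_iff_AE[OF int[of n]] nonneg by simp
  qed
  then have "AE x in M. \<forall>n. indicator {x \<in> \<Omega>. 0 < s x \<and> P n x} x * s x = 0"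
    unfolding AE_all_countable by blast
  then show ?thesis using AE_space
  proof eventually_elim
    fix x assume x: "\<forall>n. indicator {x \<in> \<Omega>. 0 < s x \<and> P n x} x * s x = 0" "x \<in> space M"
    show "(\<exists>n. P n x) \<longrightarrow> s x \<le> 0"
    proof (rule ccontr)
      assume "\<not> ?thesis"
      then obtain n where "P n x" "0 < s x" by auto
      then show False using x(1)[rule_format, of n] x(2) by simp
    qed
  qed
qed

lemma minimizer_multipliers:
  assumes min: "\<omega> \<in> minimizers G \<Omega> \<mu> lam" and "\<mu> \<noteq> 0"
  obtains W \<gamma> where
    "AE x in M. stream G \<Omega> \<omega> x - \<omega> x / lam \<le> W * snd x + \<gamma>"
    "AE x in M. 0 < \<omega> x \<longrightarrow> stream G \<Omega> \<omega> x - \<omega> x / lam = W * snd x + \<gamma>"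
proof -
  have adm: "\<omega> \<in> admissible \<Omega> \<mu>" using min by (simp add: minimizers_def)
  note \<omega> = admissible_tame[OF adm]
  have \<omega>m[measurable]: "\<omega> \<in> borel_measurable M" using \<omega> by (simp add: tame_def)
  note snd_measurable_M[measurable]
  have norm_m[measurable]: "(norm :: plane \<Rightarrow> real) \<in> borel_measurable M"
    by (rule borel_measurable_M) simp
  note \<psi>m = stream_measurable[OF \<omega>]
  define g where "g x = stream G \<Omega> \<omega> x - \<omega> x / lam" for x
  have g[measurable]: "g \<in> borel_measurable M"
    unfolding g_def using \<psi>m \<omega>m by (intro borel_measurable_diff borel_measurable_divide) auto
  \<comment> \<open>These sets exhaust the region where \<open>\<omega>\<close> is positive. On each
    of them vorticity can be removed, and it has bounded support.\<close>
  define A where "A n = {x \<in> \<Omega>. 1 / real (Suc n) < \<omega> x \<and> norm x \<le> real n}" for n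
  have A_sets: "A n \<in> sets M" for n
  proof -
    have "{x \<in> space M. 1 / real (Suc n) < \<omega> x \<and> norm x \<le> real n} \<in> sets M" by measurable
    then show ?thesis by (simp add: A_def)
  qed
  have A_cover: "\<exists>n. x \<in> A n" if x: "x \<in> \<Omega>" "0 < \<omega> x" for x
  proof -
    obtain n1 where n1: "1 / real (Suc n1) < \<omega> x"
      using reals_Archimedean[OF x(2)] by (auto simp: inverse_eq_divide)
    obtain n2 where n2: "norm x \<le> real n2" using real_arch_simple by blast
    have "1 / real (Suc (max n1 n2)) \<le> 1 / real (Suc n1)" by (intro divide_left_mono) auto
    moreover have "real n2 \<le> real (max n1 n2)" by simp
    ultimately have "1 / real (Suc (max n1 n2)) < \<omega> x" "norm x \<le> real (max n1 n2)"
      using n1 n2 by linarith+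
    then have "x \<in> A (max n1 n2)" using x by (simp add: A_def)
    then show ?thesis ..
  qed
  \<comment> \<open>Otherwise \<open>\<omega>\<close> would be nonpositive almost everywhere,
    contrary to its nonzero impulse. This \<open>A N\<close> carries the correctors for all test
    functions.\<close>
  have "\<exists>N. \<not> (AE x in M. x \<notin> A N)"
  proof (rule ccontr)
    assume "\<not> ?thesis"
    then have "AE x in M. \<forall>n. x \<notin> A n" by (simp add: AE_all_countable)
    then have "AE x in M. \<omega> x \<le> 0"
      using AE_space by eventually_elim (use A_cover in force)
    then show False
      using not_AE_nonpos[OF \<omega>] adm \<open>\<mu> \<noteq> 0\<close> by (simp add: admissible_def)
  qed
  then obtain N where N: "\<not> (AE x in M. x \<notin> A N)" ..
  have AN: "norm x \<le> real N" if "x \<in> A N" for x using that by (simp add: A_def)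
  obtain \<eta>1 \<eta>2 c where \<eta>:
    "\<eta>1 \<in> borel_measurable M" "\<eta>2 \<in> borel_measurable M"
    "\<forall>x. x \<notin> A N \<longrightarrow> \<eta>1 x = 0" "\<forall>x. x \<notin> A N \<longrightarrow> \<eta>2 x = 0"
    "\<forall>x. \<bar>\<eta>1 x\<bar> \<le> c" "\<forall>x. \<bar>\<eta>2 x\<bar> \<le> c"
    "(LINT x|M. \<eta>1 x) = 1" "(LINT x|M. snd x * \<eta>1 x) = 0"
    "(LINT x|M. \<eta>2 x) = 0" "(LINT x|M. snd x * \<eta>2 x) = 1"
    by (rule moment_dual_functions[OF A_sets AN N])
  have \<eta>0: "\<eta>1 x = 0" "\<eta>2 x = 0" if "x \<notin> A N" for x using \<eta>(3,4) that by blast+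
  have \<eta>c: "\<bar>\<eta>1 x\<bar> \<le> c" "\<bar>\<eta>2 x\<bar> \<le> c" for x using \<eta>(5,6) by blast+
  have outside: "x \<notin> A N" if "real N < norm x" for x using AN[of x] that by auto
  have d1: "tame \<eta>1" and d2: "tame \<eta>2"
    by (rule bounded_support_tame[where c = c and R = "real N"]; simp add: \<eta>(1,2) \<eta>0 \<eta>c outside)+
  have gint: "integrable M (\<lambda>x. f x * g x)" if "tame f" for f
  proof -
    have "(\<lambda>x. f x * g x) = (\<lambda>x. f x * stream G \<Omega> \<omega> x - (f x * \<omega> x) / lam)"
      by (intro ext) (simp add: g_def algebra_simps)
    then show ?thesis
      using tame_stream_integrable[OF that \<omega>] tame_product_integrable[OF that \<omega>] by simp
  qed
  \<comment> \<open>Chosen so that pairing \<open>g\<close> with a corrected test function equals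
    pairing \<open>s\<close> with the uncorrected one.\<close>
  define \<gamma> W where "\<gamma> = (LINT x|M. \<eta>1 x * g x)" and "W = (LINT x|M. \<eta>2 x * g x)"
  define s where "s x = g x - W * snd x - \<gamma>" for x
  have s[measurable]: "s \<in> borel_measurable M" unfolding s_def by measurable
  have sint: "integrable M (\<lambda>x. \<phi> x * s x)" and test: "(LINT x|M. \<phi> x * s x) \<le> 0"
    if \<phi>: "\<phi> \<in> borel_measurable M" "\<And>x. x \<in> \<Omega> \<Longrightarrow> \<bar>\<phi> x\<bar> \<le> 1" "\<And>x. x \<in> \<Omega> \<Longrightarrow> R < norm x \<Longrightarrow> \<phi> x = 0"
      "\<epsilon> > 0" "\<And>x. x \<in> \<Omega> \<Longrightarrow> 0 \<le> \<phi> x \<or> \<epsilon> \<le> \<omega> x" for \<phi> R \<epsilon>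
  proof -
    have d: "tame \<phi>" by (rule bounded_support_tame[OF \<phi>(1-3)])
    define a b where "a = (LINT x|M. \<phi> x)" and "b = (LINT x|M. snd x * \<phi> x)"
    have i: "integrable M \<phi>" "integrable M \<eta>1" "integrable M \<eta>2"
      "integrable M (\<lambda>x. snd x * \<phi> x)" "integrable M (\<lambda>x. snd x * \<eta>1 x)" "integrable M (\<lambda>x. snd x * \<eta>2 x)"
      "integrable M (\<lambda>x. \<phi> x * g x)" "integrable M (\<lambda>x. \<eta>1 x * g x)" "integrable M (\<lambda>x. \<eta>2 x * g x)"
      using d d1 d2 gint by (auto simp: tame_def)
    have s_eq: "(\<lambda>x. \<phi> x * s x) = (\<lambda>x. \<phi> x * g x - W * (snd x * \<phi> x) - \<gamma> * \<phi> x)"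
      by (intro ext) (simp add: s_def algebra_simps)
    show "integrable M (\<lambda>x. \<phi> x * s x)" unfolding s_eq using i by simp
    \<comment> \<open>Subtracting the moments keeps impulse and mass fixed. Mass is kept equal
      although the constraint is only an upper bound, so no sign of \<open>\<gamma>\<close>
      results.\<close>
    let ?\<phi> = "\<lambda>x. \<phi> x + (- a) * \<eta>1 x + (- b) * \<eta>2 x"
    have "(LINT x|M. ?\<phi> x * (stream G \<Omega> \<omega> x - \<omega> x / lam)) \<le> 0"
    proof (rule minimizer_variation_le[OF min])
      show "tame ?\<phi>" by (intro tame_add tame_cmult d d1 d2)
      show "\<bar>?\<phi> x\<bar> \<le> 1 + \<bar>a\<bar> * c + \<bar>b\<bar> * c" if "x \<in> \<Omega>" for x
      proof -
        have "\<bar>?\<phi> x\<bar> \<le> \<bar>\<phi> x\<bar> + \<bar>a\<bar> * \<bar>\<eta>1 x\<bar> + \<bar>b\<bar> * \<bar>\<eta>2 x\<bar>"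
          unfolding abs_mult[symmetric] by linarith
        also have "\<dots> \<le> 1 + \<bar>a\<bar> * c + \<bar>b\<bar> * c"
          using \<phi>(2)[OF that] \<eta>c[of x] by (intro add_mono mult_left_mono) auto
        finally show ?thesis .
      qed
      show "0 < min \<epsilon> (1 / real (Suc N))" using \<phi>(4) by simp
      \<comment> \<open>On \<open>A N\<close> the vorticity exceeds \<open>1 / real (Suc N)\<close>;
        off it the correctors vanish and the condition on \<open>\<phi>\<close> applies.\<close>
      show "0 \<le> ?\<phi> x \<or> min \<epsilon> (1 / real (Suc N)) \<le> \<omega> x" if "x \<in> \<Omega>" for x
        using \<phi>(5)[OF that] \<eta>0[of x] by (cases "x \<in> A N") (auto simp: A_def)
      show "(LINT x|M. ?\<phi> x) = 0" using i \<eta> by (simp add: a_def)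
      have "(\<lambda>x. snd x * ?\<phi> x) = (\<lambda>x. snd x * \<phi> x - a * (snd x * \<eta>1 x) - b * (snd x * \<eta>2 x))"
        by (intro ext) (simp add: algebra_simps)
      then show "(LINT x|M. snd x * ?\<phi> x) = 0" using i \<eta> by (simp add: b_def)
    qed
    also have "(\<lambda>x. ?\<phi> x * (stream G \<Omega> \<omega> x - \<omega> x / lam)) = (\<lambda>x. \<phi> x * g x - a * (\<eta>1 x * g x) - b * (\<eta>2 x * g x))"
      by (intro ext) (simp add: g_def algebra_simps)
    also have "(LINT x|M. \<phi> x * g x - a * (\<eta>1 x * g x) - b * (\<eta>2 x * g x)) = (LINT x|M. \<phi> x * g x) - a * \<gamma> - b * W"
      using i by (simp add: \<gamma>_def W_def)
    also have "\<dots> = (LINT x|M. \<phi> x * s x)"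
      unfolding s_eq using i by (simp add: a_def b_def)
    finally show "(LINT x|M. \<phi> x * s x) \<le> 0" .
  qed
  \<comment> \<open>Adding vorticity is permitted everywhere, so nonnegative indicators on balls
    give the inequality on all of \<open>\<Omega>\<close>.\<close>
  have "AE x in M. (\<exists>n. norm x \<le> real n) \<longrightarrow> s x \<le> 0"
  proof (rule AE_indicator_integral_le_zero[OF s])
    fix n :: nat
    let ?S = "{x \<in> \<Omega>. 0 < s x \<and> norm x \<le> real n}"
    have "{x \<in> space M. 0 < s x \<and> norm x \<le> real n} \<in> sets M" by measurable
    then have S: "(indicator ?S :: plane \<Rightarrow> real) \<in> borel_measurable M" by simp
    show "(LINT x|M. indicator ?S x * s x) \<le> 0"
      by (rule test[where R = "real n" and \<epsilon> = 1, OF S]) (auto simp: indicator_def)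
    show "integrable M (\<lambda>x. indicator ?S x * s x)"
      by (rule sint[where R = "real n" and \<epsilon> = 1, OF S]) (auto simp: indicator_def)
  qed
  then have le: "AE x in M. s x \<le> 0"
    by eventually_elim (use real_arch_simple in blast)
  \<comment> \<open>Removing vorticity is permitted on \<open>A n\<close> only, so the reverse
    inequality is obtained just where \<open>\<omega>\<close> is positive.\<close>
  have "AE x in M. (\<exists>n. x \<in> A n) \<longrightarrow> - s x \<le> 0"
  proof (rule AE_indicator_integral_le_zero)
    show "(\<lambda>x. - s x) \<in> borel_measurable M" by measurable
    fix n :: nat
    let ?S = "{x \<in> \<Omega>. 0 < - s x \<and> x \<in> A n}"
    have "{x \<in> space M. 0 < - s x} \<inter> A n \<in> sets M" using A_sets by (intro sets.Int) measurable
    moreover have "{x \<in> space M. 0 < - s x} \<inter> A n = ?S" by auto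
    ultimately have "(indicator ?S :: plane \<Rightarrow> real) \<in> borel_measurable M" by simp
    then have S: "(\<lambda>x. - indicator ?S x :: real) \<in> borel_measurable M" by simp
    have eq: "(\<lambda>x. indicator ?S x * - s x) = (\<lambda>x. - indicator ?S x * s x)" by (intro ext) simp
    show "(LINT x|M. indicator ?S x * - s x) \<le> 0"
      unfolding eq by (rule test[where R = "real n" and \<epsilon> = "1 / real (Suc n)", OF S]) (auto simp: indicator_def A_def)
    show "integrable M (\<lambda>x. indicator ?S x * - s x)"
      unfolding eq by (rule sint[where R = "real n" and \<epsilon> = "1 / real (Suc n)", OF S]) (auto simp: indicator_def A_def)
  qed
  then have ge: "AE x in M. 0 < \<omega> x \<longrightarrow> s x \<ge> 0"
    using AE_space by eventually_elim (use A_cover in auto)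
  show thesis
  proof (rule that)
    show "AE x in M. stream G \<Omega> \<omega> x - \<omega> x / lam \<le> W * snd x + \<gamma>"
      using le by eventually_elim (simp add: s_def g_def)
    show "AE x in M. 0 < \<omega> x \<longrightarrow> stream G \<Omega> \<omega> x - \<omega> x / lam = W * snd x + \<gamma>"
      using le ge by eventually_elim (auto simp: s_def g_def)
  qed
qed

section \<open>Uniqueness of the multipliers and the profile of a minimizer\<close>

text \<open>Where \<open>\<omega>\<close> is positive both positive parts are active, so
  \<open>\<psi>\<close> cancels and an affine relation in \<open>snd x\<close> remains. It fixes
  \<open>W\<close> first, then \<open>\<gamma>\<close>.\<close>

lemma profile_unique:
  assumes pos: "\<not> (AE x in M. \<omega> x \<le> 0)" and "0 < lam"
    and 1: "AE x in M. \<omega> x = lam * max (\<psi> x - W * snd x - \<gamma>) 0"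
    and 2: "AE x in M. \<omega> x = lam * max (\<psi> x - W' * snd x - \<gamma>') 0"
  shows "W = W' \<and> \<gamma> = \<gamma>'"
proof -
  have lin: "AE x in M. 0 < \<omega> x \<longrightarrow> (W - W') * snd x = \<gamma>' - \<gamma>"
    using 1 2
  proof eventually_elim
    fix x assume x: "\<omega> x = lam * max (\<psi> x - W * snd x - \<gamma>) 0" "\<omega> x = lam * max (\<psi> x - W' * snd x - \<gamma>') 0"
    show "0 < \<omega> x \<longrightarrow> (W - W') * snd x = \<gamma>' - \<gamma>"
    proof
      assume "0 < \<omega> x"
      have "max (\<psi> x - W * snd x - \<gamma>) 0 = max (\<psi> x - W' * snd x - \<gamma>') 0"
        using x \<open>0 < lam\<close> by simp
      moreover have "max (\<psi> x - W * snd x - \<gamma>) 0 > 0"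
        using x(1) \<open>0 < \<omega> x\<close> \<open>0 < lam\<close> by (simp add: zero_less_mult_iff)
      ultimately show "(W - W') * snd x = \<gamma>' - \<gamma>"
        by (simp add: max_def algebra_simps split: if_splits)
    qed
  qed
  have W: "W = W'"
  proof (rule ccontr)
    assume "W \<noteq> W'"
    from lin horizontal_line_null[of "(\<gamma>' - \<gamma>) / (W - W')"]
    have "AE x in M. \<omega> x \<le> 0"
    proof eventually_elim
      fix x assume "0 < \<omega> x \<longrightarrow> (W - W') * snd x = \<gamma>' - \<gamma>" "snd x \<noteq> (\<gamma>' - \<gamma>) / (W - W')"
      then show "\<omega> x \<le> 0" using \<open>W \<noteq> W'\<close> by (auto simp: field_simps not_less[symmetric])
    qed
    then show False using pos by simp
  qed
  moreover have "\<gamma> = \<gamma>'"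
  proof (rule ccontr)
    assume "\<gamma> \<noteq> \<gamma>'"
    then have "AE x in M. \<omega> x \<le> 0"
      using lin by (auto simp: W not_less elim: eventually_mono)
    then show False using pos by simp
  qed
  ultimately show ?thesis ..
qed

end

theorem proposition2p6:
  fixes \<Omega> :: "plane set" and G :: "plane \<Rightarrow> plane \<Rightarrow> real"
    and \<mu> lam :: real and \<omega> :: "plane \<Rightarrow> real"
  assumes "green_function \<Omega> G"
    and "class1 \<Omega> G \<or> (\<exists>L>0. \<Omega> = strip L)"
    and "\<exists>K. K \<in> sets lebesgue \<and> K \<subseteq> \<Omega> \<and>
           0 < emeasure lebesgue K \<and> emeasure lebesgue K < \<infinity> \<and>
           0 < \<mu> \<and> ennreal \<mu> \<le> mu_of K \<and> lambda_of G K < ennreal lam"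
    and "\<omega> \<in> minimizers G \<Omega> \<mu> lam"
  shows "\<exists>!(p :: real \<times> real). case p of (W, \<gamma>) \<Rightarrow>
           (AE x in lebesgue_on \<Omega>.
              \<omega> x = lam * max (stream G \<Omega> \<omega> x - W * snd x - \<gamma>) 0)"
proof -
  have "open \<Omega>" "\<Omega> \<subseteq> upper_half_plane"
    using assms(2) by (auto simp: class1_def strip_def upper_half_plane_def intro: open_Times)
  then interpret green_domain \<Omega> G
    using assms(1) by unfold_locales
  obtain K where "0 < \<mu>" "lambda_of G K < ennreal lam" using assms(3) by blast
  \<comment> \<open>\<open>lambda_of G K\<close> is an extended nonnegative real, so lying strictly
    below \<open>ennreal lam\<close> forces \<open>lam\<close> to be positive.\<close>
  then have "0 < lam" using le_less_trans[OF zero_le, of "lambda_of G K" "ennreal lam"] by simp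
  have adm: "\<omega> \<in> admissible \<Omega> \<mu>" using assms(4) by (simp add: minimizers_def)
  then have nonneg: "AE x in M. 0 \<le> \<omega> x" by (simp add: admissible_def)
  have pos: "\<not> (AE x in M. \<omega> x \<le> 0)"
    using not_AE_nonpos[OF admissible_tame[OF adm]] adm \<open>0 < \<mu>\<close> by (simp add: admissible_def)
  obtain W \<gamma> where
    le: "AE x in M. stream G \<Omega> \<omega> x - \<omega> x / lam \<le> W * snd x + \<gamma>" and
    eq: "AE x in M. 0 < \<omega> x \<longrightarrow> stream G \<Omega> \<omega> x - \<omega> x / lam = W * snd x + \<gamma>"
    by (rule minimizer_multipliers[OF assms(4)]) (use \<open>0 < \<mu>\<close> in auto)
  \<comment> \<open>Equality settles the points with \<open>\<omega> x > 0\<close>; where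
    \<open>\<omega> x = 0\<close> the inequality says that the argument of the positive part is
    nonpositive.\<close>
  have profile: "AE x in M. \<omega> x = lam * max (stream G \<Omega> \<omega> x - W * snd x - \<gamma>) 0"
    using le eq nonneg
  proof eventually_elim
    fix x assume x: "stream G \<Omega> \<omega> x - \<omega> x / lam \<le> W * snd x + \<gamma>"
      "0 < \<omega> x \<longrightarrow> stream G \<Omega> \<omega> x - \<omega> x / lam = W * snd x + \<gamma>" "0 \<le> \<omega> x"
    show "\<omega> x = lam * max (stream G \<Omega> \<omega> x - W * snd x - \<gamma>) 0"
    proof (cases "0 < \<omega> x")
      case True
      then have "stream G \<Omega> \<omega> x - W * snd x - \<gamma> = \<omega> x / lam" using x(2) by simp
      moreover have "0 < \<omega> x / lam" using True \<open>0 < lam\<close> by simp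
      ultimately show ?thesis using \<open>0 < lam\<close> by (simp add: max_def)
    next
      case False
      then have "\<omega> x = 0" using x(3) by simp
      then show ?thesis using x(1) by (simp add: max_def)
    qed
  qed
  show ?thesis
  proof (rule ex1I[of _ "(W, \<gamma>)"])
    fix p :: "real \<times> real"
    assume p: "case p of (W, \<gamma>) \<Rightarrow> AE x in M. \<omega> x = lam * max (stream G \<Omega> \<omega> x - W * snd x - \<gamma>) 0"
    obtain W' \<gamma>' where [simp]: "p = (W', \<gamma>')" by fastforce
    show "p = (W, \<gamma>)"
      using profile_unique[OF pos \<open>0 < lam\<close> profile, of W' \<gamma>'] p by simp
  qed (simp add: profile)
qed

end
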